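(* Let $\mathcal{P}=(P,d\mu,d\sigma)$ be an $n$-dimensional system with $n\ge2$. There exists a lower semicontinuous convex function $U:P\to[0,\infty]$ such that $U\in L^q(P,d\mu)$ for every $q\in[1,\frac{n}{n-1})$ and \[ u(x)\le\int_{\partial P}u\,d\sigma\cdot U(x) \] for every non-negative lower semicontinuous convex function $u:P\to[0,\infty]$ and every $x\in P$. Moreover, $U$ can be chosen so that it is finite-valued and continuous on $P\setminus\partial^2P$, and so that for each $x\in\partial^2P$ lying in the relative interior of a face of codimension $p\ge2$ there is a neighbourhood $V$ of $x$ in $P$ with $U|_V\in L^r(V,d\mu|_V)$ for every $r\in[1,\frac{p}{p-1})$.
   Context: An $n$-dimensional system is a triple $\mathcal{P}=(P,d\mu,d\sigma)$ where $P$ is a simple polytope in an $n$-dimensional real affine space $V$ (a compact subset with non-empty interior that is a finite intersection of closed half spaces, such that every vertex is the intersection of exactly $n$ facets), $d\mu$ is the restriction to $P$ of a translation-invariant measure on $V$ that is positive and finite on bounded non-empty open sets (i.e. a positive multiple of Lebesgue measure), and $d\sigma$ is a measure on the boundary $\partial P$ whose restriction to each facet is a positive multiple of the Lebesgue measure of the affine hyperplane spanned by that facet. $\partial^2P$ denotes the union of all faces of $P$ of codimension at least $2$. *)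

theory Defs
  imports "HOL-Analysis.Analysis"
begin

definition simple_polytope :: "'a::euclidean_space set \<Rightarrow> bool" where
  "simple_polytope P \<longleftrightarrow> polyhedron P \<and> compact P \<and> interior P \<noteq> {} \<and>
     (\<forall>v. {v} face_of P \<longrightarrow> card {F. F facet_of P \<and> v \<in> F} = DIM('a))"

definition facet_eqn :: "'a::euclidean_space set \<Rightarrow> 'a \<times> real" where
  "facet_eqn F = (SOME (a, b). norm a = 1 \<and> affine hull F = {x. a \<bullet> x = b})"

text \<open>Lebesgue measure of the affine hyperplane {x. a . x = b} (a a unit vector), obtained as
the image of n-dimensional Lebesgue measure on the unit-thickness slab over the hyperplane
under the orthogonal projection onto the hyperplane.\<close>
definition hyperplane_lebesgue :: "'a::euclidean_space \<Rightarrow> real \<Rightarrow> 'a measure" where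
  "hyperplane_lebesgue a b =
     distr (density lborel (indicator {z. b \<le> a \<bullet> z \<and> a \<bullet> z \<le> b + 1})) borel
           (\<lambda>z. z - (a \<bullet> z - b) *\<^sub>R a)"

definition facet_lebesgue :: "'a::euclidean_space set \<Rightarrow> 'a measure" where
  "facet_lebesgue F = hyperplane_lebesgue (fst (facet_eqn F)) (snd (facet_eqn F))"

text \<open>Integral over the boundary w.r.t. d sigma, where d sigma restricted to the facet F is
c F times the Lebesgue measure of the hyperplane spanned by F.\<close>
definition boundary_integral ::
  "'a::euclidean_space set \<Rightarrow> ('a set \<Rightarrow> real) \<Rightarrow> ('a \<Rightarrow> ennreal) \<Rightarrow> ennreal" where
  "boundary_integral P c u =
     (\<Sum>F\<in>{F. F facet_of P}. ennreal (c F) * (\<integral>\<^sup>+ x\<in>F. u x \<partial>facet_lebesgue F))"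

text \<open>n-dimensional system (P, d mu, d sigma): d mu = cmu * Lebesgue, cmu > 0; c F > 0.\<close>
definition nsystem :: "'a::euclidean_space set \<Rightarrow> real \<Rightarrow> ('a set \<Rightarrow> real) \<Rightarrow> bool" where
  "nsystem P cmu c \<longleftrightarrow> simple_polytope P \<and> cmu > 0 \<and> (\<forall>F. F facet_of P \<longrightarrow> c F > 0)"

definition enn_convex_on :: "'a::real_vector set \<Rightarrow> ('a \<Rightarrow> ennreal) \<Rightarrow> bool" where
  "enn_convex_on S u \<longleftrightarrow> (\<forall>x\<in>S. \<forall>y\<in>S. \<forall>t::real. 0 \<le> t \<and> t \<le> 1 \<longrightarrow>
      u ((1 - t) *\<^sub>R x + t *\<^sub>R y) \<le> ennreal (1 - t) * u x + ennreal t * u y)"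

definition lsc_on :: "'a::topological_space set \<Rightarrow> ('a \<Rightarrow> ennreal) \<Rightarrow> bool" where
  "lsc_on S u \<longleftrightarrow> (\<forall>x\<in>S. u x \<le> Liminf (at x within S) u)"

definition enn_pow :: "ennreal \<Rightarrow> real \<Rightarrow> ennreal" where
  "enn_pow v q = (if v = \<infinity> then \<infinity> else ennreal (enn2real v powr q))"

definition in_Lq :: "real \<Rightarrow> real \<Rightarrow> 'a::euclidean_space set \<Rightarrow> ('a \<Rightarrow> ennreal) \<Rightarrow> bool" where
  "in_Lq cmu q S U \<longleftrightarrow> U \<in> borel_measurable (restrict_space lborel S) \<and>
     (\<integral>\<^sup>+ x\<in>S. ennreal cmu * enn_pow (U x) q \<partial>lborel) < \<infinity>"

definition boundary2 :: "'a::euclidean_space set \<Rightarrow> 'a set" where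
  "boundary2 P = \<Union>{G. G face_of P \<and> aff_dim G \<le> int DIM('a) - 2}"

end

theory Submission
  imports Defs
begin

text \<open>Take \<open>U x\<close> to be the supremum of \<open>u x\<close> over all lower semicontinuous convex \<open>u\<close> with
  boundary integral at most 1. Everything then reduces to bounding such \<open>u\<close> near a point \<open>x0\<close> lying on
  exactly the facets \<open>F_1, ..., F_m\<close>, with distances \<open>l_1, ..., l_m\<close> to them.

  If \<open>x\<close> has a \<open>\<delta>\<close>-ball inside \<open>P\<close>, then \<open>u \<ge> u x\<close> on the part of \<open>P\<close> in some half space through \<open>x\<close>,
  hence near some vertex of \<open>P\<close>, and there are only finitely many vertices. If \<open>x\<close> lies on \<open>F_i\<close>, the mean
  of \<open>u\<close> over a parallelepiped in \<open>F_i\<close> centred at \<open>x\<close> is at least \<open>u x\<close>, and by simplicity of \<open>P\<close> its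
  measure is comparable to the product of the \<open>l_j x\<close> with \<open>j \<noteq> i\<close>. Any other \<open>x\<close> near \<open>x0\<close>, \<open>F_i\<close> being the
  nearest facet, is a convex combination of points of these two kinds. So \<open>U\<close> is bounded by a multiple
  of the product of \<open>1 / l_j\<close> over \<open>j \<noteq> i\<close>, hence, \<open>l_i\<close> being minimal, of the product of
  \<open>l_j powr - ((m - 1) / m)\<close> over all \<open>j\<close>, whose \<open>r\<close>-th power is integrable iff \<open>r (m - 1) < m\<close>. For
  \<open>m \<le> 1\<close> this is local boundedness, and locally bounded convex functions on a polytope are upper
  semicontinuous.\<close>

section \<open>Lebesgue measure and linear coordinates\<close>

lemma emeasure_lborel_translate:
  fixes A :: "'a::euclidean_space set"
  assumes "A \<in> sets borel"
  shows "emeasure lborel {y. c + y \<in> A} = emeasure lborel A"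
proof -
  have "emeasure lborel A = emeasure (distr lborel borel ((+) c)) A"
    by (simp add: lborel_distr_plus)
  also have "\<dots> = emeasure lborel ((+) c -` A \<inter> space lborel)"
    using assms by (subst emeasure_distr) auto
  finally show ?thesis by (simp add: vimage_def)
qed

lemma emeasure_lborel_open_pos:
  fixes A :: "'a::euclidean_space set"
  assumes "open A" "A \<noteq> {}"
  shows "emeasure lborel A > 0"
proof (rule ccontr)
  assume "\<not> emeasure lborel A > 0"
  then have "A \<in> null_sets lborel" using assms(1) by (auto simp: null_sets_def)
  then have "negligible A" by (simp add: negligible_iff_null_sets null_sets_completionI)
  then show False using open_not_negligible assms by blast
qed

lemma nn_integral_lborel_reflect:
  fixes f :: "'a::euclidean_space \<Rightarrow> ennreal"
  assumes [measurable]: "f \<in> borel_measurable borel"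
  shows "(\<integral>\<^sup>+z. f (c - z) \<partial>lborel) = (\<integral>\<^sup>+z. f z \<partial>lborel)"
proof -
  have "(lborel :: 'a measure) = density (distr lborel borel (\<lambda>x. c + (-1) *\<^sub>R x)) (\<lambda>_. ennreal (\<bar>-1\<bar>^DIM('a)))"
    by (rule lborel_affine) simp
  then have eq: "(lborel :: 'a measure) = distr lborel borel (\<lambda>x. c - x)"
    by (simp add: density_1)
  show ?thesis by (subst (2) eq, subst nn_integral_distr) auto
qed

text \<open>Uniqueness of translation-invariant measures: integrate the indicator of
  \<open>{(x, y). T x \<in> A \<and> T x + y \<in> Q}\<close> in both orders, \<open>Q\<close> the unit cube.\<close>
lemma distr_lborel_linear:
  fixes T :: "'a::euclidean_space \<Rightarrow> 'a"
  assumes T: "linear T" "bij T"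
  obtains k :: real where "k > 0" "distr lborel borel T = density lborel (\<lambda>_. ennreal k)"
proof -
  have [measurable]: "T \<in> borel_measurable borel"
    using T(1) by (intro borel_measurable_continuous_onI linear_continuous_on linear_conv_bounded_linear[THEN iffD1])
  define Q where "Q = cbox (0::'a) One"
  have Q[measurable]: "Q \<in> sets borel" by (simp add: Q_def)
  have Q1: "emeasure lborel Q = 1"
    by (simp add: Q_def emeasure_lborel_cbox_eq)
  \<comment> \<open>The constant will be the volume of the preimage of the unit cube: finite because
    that preimage is bounded, positive because it contains the preimage of the open cube.\<close>
  define TQ where "TQ = T -` Q"
  have TQ[measurable]: "TQ \<in> sets borel"
    unfolding TQ_def by (metis Q \<open>T \<in> borel_measurable borel\<close> measurable_sets_borel)
  have invT: "linear (inv T)" using T by (simp add: bij_is_inj bij_is_surj inj_linear_imp_inv_linear linear_injective_imp_surjective)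
  have TQ_eq: "TQ = inv T ` Q"
    unfolding TQ_def using T(2) by (simp add: bij_vimage_eq_inv_image)
  have "bounded TQ"
    unfolding TQ_eq using invT by (intro bounded_linear_image) (auto simp: Q_def linear_conv_bounded_linear)
  then have fin: "emeasure lborel TQ < \<infinity>"
    by (rule emeasure_bounded_finite)
  have "open (T -` box 0 One)"
    using T(1) by (intro open_vimage open_box linear_continuous_on linear_conv_bounded_linear[THEN iffD1])
  moreover have "T -` box 0 One \<noteq> {}"
    using T(2) box_ne_empty(2)[of "0::'a" One] by (auto simp: bij_is_surj surj_vimage_empty)
  ultimately have "emeasure lborel (T -` box 0 One) > 0"
    by (rule emeasure_lborel_open_pos)
  moreover have "emeasure lborel (T -` box 0 One) \<le> emeasure lborel TQ"
    using TQ by (intro emeasure_mono) (auto simp: TQ_def Q_def box_subset_cbox[THEN subsetD])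
  ultimately have pos: "emeasure lborel TQ > 0" by (rule less_le_trans)
  define k where "k = enn2real (emeasure lborel TQ)"
  have k: "k > 0" "ennreal k = emeasure lborel TQ"
    using fin pos by (auto simp: k_def enn2real_positive_iff)
  have "distr lborel borel T = density lborel (\<lambda>_. ennreal k)"
  proof (rule measure_eqI)
    fix A assume "A \<in> sets (distr lborel borel T)"
    then have A[measurable]: "A \<in> sets borel" by simp
    define f :: "'a \<Rightarrow> 'a \<Rightarrow> ennreal" where "f x y = indicator A (T x) * indicator Q (T x + y)" for x y
    have [measurable]: "case_prod f \<in> borel_measurable (lborel \<Otimes>\<^sub>M lborel)"
      unfolding f_def by measurable
    have "(\<integral>\<^sup>+x. \<integral>\<^sup>+y. f x y \<partial>lborel \<partial>lborel) = (\<integral>\<^sup>+x. indicator A (T x) \<partial>lborel)"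
    proof (rule nn_integral_cong)
      fix x
      have "(\<integral>\<^sup>+y. f x y \<partial>lborel) = indicator A (T x) * (\<integral>\<^sup>+y. indicator {y. T x + y \<in> Q} y \<partial>lborel)"
        unfolding f_def by (subst nn_integral_cmult[symmetric]) (auto simp: indicator_def)
      also have "(\<integral>\<^sup>+y. indicator {y. T x + y \<in> Q} y \<partial>lborel) = 1"
        by (subst nn_integral_indicator) (auto simp: emeasure_lborel_translate Q1)
      finally show "(\<integral>\<^sup>+y. f x y \<partial>lborel) = indicator A (T x)" by simp
    qed
    also have "\<dots> = (\<integral>\<^sup>+x. indicator (T -` A) x \<partial>lborel)"
      by (simp add: indicator_def)
    also have "\<dots> = emeasure (distr lborel borel T) A"
      using measurable_sets_borel[OF \<open>T \<in> borel_measurable borel\<close> A]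
      by (subst emeasure_distr) auto
    finally have 1: "(\<integral>\<^sup>+x. \<integral>\<^sup>+y. f x y \<partial>lborel \<partial>lborel) = emeasure (distr lborel borel T) A" .
    have "(\<integral>\<^sup>+x. \<integral>\<^sup>+y. f x y \<partial>lborel \<partial>lborel) = (\<integral>\<^sup>+y. \<integral>\<^sup>+x. f x y \<partial>lborel \<partial>lborel)"
      by (rule lborel_pair.Fubini'[symmetric]) simp
    also have "\<dots> = (\<integral>\<^sup>+y. \<integral>\<^sup>+x. indicator Q (T x) * indicator A (T x - y) \<partial>lborel \<partial>lborel)"
    proof (rule nn_integral_cong)
      fix y
      \<comment> \<open>Translating \<open>x\<close> by \<open>-w\<close> subtracts \<open>y\<close>
        from \<open>T x\<close>, which moves \<open>y\<close> from the cube factor to the factor of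
        \<open>A\<close>. After the second exchange of integrals, the inner integral no longer sees
        \<open>T\<close>.\<close>
      define w where "w = inv T y"
      have w: "T (x - w) = T x - y" for x
        using surj_f_inv_f[OF bij_is_surj[OF T(2)], of y] T(1)
        by (simp add: w_def linear_add linear_neg linear_diff)
      have [measurable]: "(\<lambda>x. f x y) \<in> borel_measurable borel"
        unfolding f_def by measurable
      have "(\<integral>\<^sup>+x. f x y \<partial>lborel) = (\<integral>\<^sup>+x. f x y \<partial>distr lborel borel ((+) (-w)))"
        by (simp only: lborel_distr_plus)
      also have "\<dots> = (\<integral>\<^sup>+x. f (-w + x) y \<partial>lborel)"
        by (subst nn_integral_distr) auto
      finally show "(\<integral>\<^sup>+x. f x y \<partial>lborel) = (\<integral>\<^sup>+x. indicator Q (T x) * indicator A (T x - y) \<partial>lborel)"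
        by (simp add: f_def w mult.commute)
    qed
    also have "\<dots> = (\<integral>\<^sup>+x. \<integral>\<^sup>+y. indicator Q (T x) * indicator A (T x - y) \<partial>lborel \<partial>lborel)"
      by (rule lborel_pair.Fubini') measurable
    also have "\<dots> = (\<integral>\<^sup>+x. emeasure lborel A * indicator TQ x \<partial>lborel)"
    proof (rule nn_integral_cong)
      fix x
      have "(\<integral>\<^sup>+y. indicator A (T x - y) \<partial>lborel) = emeasure lborel A"
        by (subst nn_integral_lborel_reflect) auto
      then show "(\<integral>\<^sup>+y. indicator Q (T x) * indicator A (T x - y) \<partial>lborel) = emeasure lborel A * indicator TQ x"
        by (subst nn_integral_cmult) (auto simp: TQ_def indicator_def)
    qed
    also have "\<dots> = emeasure lborel A * ennreal k"
      by (subst nn_integral_cmult) (auto simp: k)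
    finally show "emeasure (distr lborel borel T) A = emeasure (density lborel (\<lambda>_. ennreal k)) A"
      using 1 by (simp add: emeasure_density nn_integral_cmult mult.commute)
  qed simp
  with k(1) show thesis by (rule that)
qed

lemma nn_integral_lborel_linear:
  fixes T :: "'a::euclidean_space \<Rightarrow> 'a"
  assumes T: "linear T" "bij T"
  obtains k :: real where "k > 0"
    "\<And>f. f \<in> borel_measurable borel \<Longrightarrow> (\<integral>\<^sup>+z. f (T z) \<partial>lborel) = ennreal k * (\<integral>\<^sup>+z. f z \<partial>lborel)"
proof -
  obtain k where k: "k > 0" "distr lborel borel T = density lborel (\<lambda>_. ennreal k)"
    by (rule distr_lborel_linear[OF T])
  have [measurable]: "T \<in> borel_measurable borel"
    using T(1) by (intro borel_measurable_continuous_onI linear_continuous_on linear_conv_bounded_linear[THEN iffD1])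
  have "(\<integral>\<^sup>+z. f (T z) \<partial>lborel) = ennreal k * (\<integral>\<^sup>+z. f z \<partial>lborel)"
    if [measurable]: "f \<in> borel_measurable borel" for f
  proof -
    have "(\<integral>\<^sup>+z. f (T z) \<partial>lborel) = (\<integral>\<^sup>+z. f z \<partial>distr lborel borel T)"
      by (subst nn_integral_distr) auto
    also have "\<dots> = (\<integral>\<^sup>+z. ennreal k * f z \<partial>lborel)"
      unfolding k by (subst nn_integral_density) auto
    also have "\<dots> = ennreal k * (\<integral>\<^sup>+z. f z \<partial>lborel)"
      by (rule nn_integral_cmult) auto
    finally show ?thesis .
  qed
  with k(1) show thesis by (rule that)
qed

lemma linear_coordinates_extend:
  fixes f :: "'i \<Rightarrow> 'a::euclidean_space"
  assumes inj: "inj_on f J" and ind: "independent (f ` J)"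
  obtains S :: "'a \<Rightarrow> 'a" and \<phi> where "linear S" "bij S" "inj_on \<phi> J" "\<phi> ` J \<subseteq> Basis"
    "\<And>j z. j \<in> J \<Longrightarrow> S z \<bullet> \<phi> j = f j \<bullet> z"
proof -
  obtain B where B: "f ` J \<subseteq> B" "independent B" "span B = UNIV"
    using maximal_independent_subset_extend[OF subset_UNIV ind] by (metis UNIV_I subsetI subset_antisym)
  have cB: "finite B" "card B = DIM('a)"
    using indep_card_eq_dim_span[OF B(2)] independent_imp_finite[OF B(2)] unfolding B(3) by (simp_all add: dim_UNIV)
  obtain \<psi> where \<psi>: "bij_betw \<psi> B (Basis::'a set)"
    using cB by (metis finite_Basis finite_same_card_bij)
  define S where "S z = (\<Sum>v\<in>B. (v \<bullet> z) *\<^sub>R \<psi> v)" for z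
  have linS: "linear S"
    unfolding S_def by (intro linear_compose_sum ballI linearI) (auto simp: inner_add_right algebra_simps)
  have Sin: "S z \<bullet> \<psi> w = w \<bullet> z" if "w \<in> B" for w z
  proof -
    have "S z \<bullet> \<psi> w = (\<Sum>v\<in>B. (v \<bullet> z) * (\<psi> v \<bullet> \<psi> w))"
      by (simp add: S_def inner_sum_left)
    also have "\<dots> = (\<Sum>v\<in>B. if v = w then v \<bullet> z else 0)"
    proof (rule sum.cong)
      fix v assume v: "v \<in> B"
      have "\<psi> v \<in> Basis" "\<psi> w \<in> Basis" "\<psi> v = \<psi> w \<longleftrightarrow> v = w"
        using \<psi> v that by (auto simp: bij_betw_def inj_on_def)
      then show "(v \<bullet> z) * (\<psi> v \<bullet> \<psi> w) = (if v = w then v \<bullet> z else 0)"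
        by (auto simp: inner_Basis)
    qed simp
    finally show ?thesis using that cB by simp
  qed
  have "inj S"
  proof (rule linear_injective_0[OF linS, THEN iffD2], intro allI impI)
    fix z assume "S z = 0"
    then have *: "\<And>v. v \<in> B \<Longrightarrow> orthogonal z v" using Sin[of _ z] by (simp add: orthogonal_def inner_commute)
    have "orthogonal z z" by (rule orthogonal_to_span[of z B]) (use * B in auto)
    then show "z = 0" by (simp add: orthogonal_def)
  qed
  then have "bij S" using linS by (simp add: bij_def linear_injective_imp_surjective)
  moreover have "inj_on (\<psi> \<circ> f) J"
    by (rule comp_inj_on[OF inj inj_on_subset[OF bij_betw_imp_inj_on[OF \<psi>] B(1)]])
  moreover have "(\<psi> \<circ> f) ` J \<subseteq> Basis"
    using B(1) \<psi> by (auto simp: bij_betw_def)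
  ultimately show thesis using linS Sin B(1) by (intro that[of S "\<psi> \<circ> f"]) auto
qed

text \<open>Invert the coordinate map of the extended basis. Applied to facet normals, this supplies
  directions along which the distances to the facets change at prescribed rates.\<close>

lemma independent_inner_solve:
  fixes f :: "'i \<Rightarrow> 'a::euclidean_space"
  assumes "inj_on f J" "independent (f ` J)"
  obtains d where "\<And>j. j \<in> J \<Longrightarrow> f j \<bullet> d = g j"
proof -
  obtain S :: "'a \<Rightarrow> 'a" and \<phi> where S: "linear S" "bij S" "inj_on \<phi> J" "\<phi> ` J \<subseteq> Basis"
    "\<And>j z. j \<in> J \<Longrightarrow> S z \<bullet> \<phi> j = f j \<bullet> z"
    by (rule linear_coordinates_extend[OF assms]) (rule that)
  define d where "d = inv S (\<Sum>b\<in>\<phi> ` J. g (inv_into J \<phi> b) *\<^sub>R b)"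
  have "f j \<bullet> d = g j" if "j \<in> J" for j
  proof -
    have "f j \<bullet> d = (\<Sum>b\<in>\<phi> ` J. g (inv_into J \<phi> b) *\<^sub>R b) \<bullet> \<phi> j"
      using S(2) by (subst S(5)[OF that, symmetric]) (simp add: d_def bij_is_surj surj_f_inv_f)
    also have "\<dots> = (\<Sum>b\<in>\<phi> ` J. if b = \<phi> j then g (inv_into J \<phi> b) else 0)"
      unfolding inner_sum_left using S(4) that
      by (intro sum.cong) (auto simp: inner_Basis image_subset_iff)
    also have "\<dots> = g j"
      using S(3,4) that finite_subset[OF S(4) finite_Basis] by simp
    finally show ?thesis .
  qed
  then show thesis by (rule that)
qed

text \<open>A vector in the span of the others would be orthogonal to its own partner
  \<open>D i\<close>.\<close>

lemma independent_if_biorthogonal: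
  fixes f :: "'i \<Rightarrow> 'a::euclidean_space"
  assumes "\<And>i. i \<in> J \<Longrightarrow> f i \<bullet> D i \<noteq> 0"
    and "\<And>i j. i \<in> J \<Longrightarrow> j \<in> J \<Longrightarrow> i \<noteq> j \<Longrightarrow> f j \<bullet> D i = 0"
  shows "inj_on f J" "independent (f ` J)"
proof -
  show inj: "inj_on f J"
  proof (rule inj_onI, rule ccontr)
    fix i j assume "i \<in> J" "j \<in> J" "f i = f j" "i \<noteq> j"
    then show False using assms(1)[of i] assms(2)[of i j] by simp
  qed
  show "independent (f ` J)"
  proof (rule ccontr)
    assume "\<not> independent (f ` J)"
    then obtain i where i: "i \<in> J" "f i \<in> span (f ` J - {f i})"
      by (auto simp: dependent_def)
    have "orthogonal (D i) (f i)"
    proof (rule orthogonal_to_span[OF i(2)])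
      fix y assume "y \<in> f ` J - {f i}"
      then show "orthogonal (D i) y"
        using assms(2)[OF i(1)] by (force simp: orthogonal_def inner_commute)
    qed
    then show False using assms(1)[OF i(1)] by (simp add: orthogonal_def inner_commute)
  qed
qed

text \<open>In coordinates extending the functionals \<open>f j\<close>, the set contains a box
  whose edges are proportional to \<open>h j\<close> for \<open>j \<in> J\<close> and of fixed
  length otherwise. What matters is that \<kappa> depends neither on the centre nor on the
  widths.\<close>

lemma emeasure_parallelepiped_ge:
  fixes f :: "'i \<Rightarrow> 'a::euclidean_space"
  assumes inj: "inj_on f J" and ind: "independent (f ` J)" and "\<delta> > 0"
  obtains \<kappa> :: real where "\<kappa> > 0"
    "\<And>c h. (\<And>j. j \<in> J \<Longrightarrow> 0 \<le> h j \<and> h j \<le> 1) \<Longrightarrow>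
       ennreal (\<kappa> * (\<Prod>j\<in>J. h j)) \<le>
       emeasure lborel {z. dist z c < \<delta> \<and> (\<forall>j\<in>J. \<bar>f j \<bullet> (z - c)\<bar> \<le> h j)}"
proof -
  obtain S :: "'a \<Rightarrow> 'a" and \<phi> where S: "linear S" "bij S" "inj_on \<phi> J" "\<phi> ` J \<subseteq> Basis"
    "\<And>j z. j \<in> J \<Longrightarrow> S z \<bullet> \<phi> j = f j \<bullet> z"
    by (rule linear_coordinates_extend[OF inj ind]) (rule that)
  obtain k where k: "k > 0"
    "\<And>f. f \<in> borel_measurable borel \<Longrightarrow> (\<integral>\<^sup>+z. f (S z) \<partial>lborel) = ennreal k * (\<integral>\<^sup>+z. f z \<partial>lborel)"
    by (rule nn_integral_lborel_linear[OF S(1,2)]) (rule that)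
  obtain B where B: "B > 0" "\<And>z. B * norm z \<le> norm (S z)"
    using linear_inj_bounded_below_pos[OF S(1) bij_is_inj[OF S(2)]] by metis
  have [measurable]: "S \<in> borel_measurable borel"
    using S(1) by (intro borel_measurable_continuous_onI linear_continuous_on linear_conv_bounded_linear[THEN iffD1])
  have finJ: "finite J"
    using S(3,4) by (metis finite_Basis finite_imageD finite_subset)
  \<comment> \<open>The half edges of the box are at most \<open>t\<close>, so its points have l1
    norm at most \<open>DIM('a) * t\<close>, which must be below \<open>B * \<delta>\<close> for the
    preimage under \<open>S\<close> to stay in the \<delta>-ball.\<close>
  define t where "t = min 1 (B * \<delta> / (2 * DIM('a)))"
  have t: "0 < t" "t \<le> 1" "DIM('a) * t < B * \<delta>"
  proof -
    have "DIM('a) * t \<le> DIM('a) * (B * \<delta> / (2 * DIM('a)))"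
      by (intro mult_left_mono) (auto simp: t_def)
    also have "\<dots> < B * \<delta>" using B(1) \<open>\<delta> > 0\<close> by simp
    finally show "DIM('a) * t < B * \<delta>" .
  qed (use B(1) \<open>\<delta> > 0\<close> in \<open>auto simp: t_def\<close>)
  define \<kappa> where "\<kappa> = k * (2 * t) ^ DIM('a)"
  have main: "ennreal (\<kappa> * (\<Prod>j\<in>J. h j)) \<le>
       emeasure lborel {z. dist z c < \<delta> \<and> (\<forall>j\<in>J. \<bar>f j \<bullet> (z - c)\<bar> \<le> h j)}"
    if h: "\<And>j. j \<in> J \<Longrightarrow> 0 \<le> h j \<and> h j \<le> 1" for c h
  proof -
    \<comment> \<open>The widths are extended by 1 to the remaining coordinates, which leaves the
      product unchanged.\<close>
    define g where "g b = (if b \<in> \<phi> ` J then h (inv_into J \<phi> b) else 1)" for b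
    have g: "0 \<le> g b" "g b \<le> 1" for b
      using h by (auto simp: g_def inv_into_into)
    have g\<phi>: "g (\<phi> j) = h j" if "j \<in> J" for j
      using that S(3) by (simp add: g_def)
    define v where "v = (\<Sum>b\<in>Basis. (t * g b) *\<^sub>R b)"
    have v: "v \<bullet> b = t * g b" if "b \<in> Basis" for b
      using that by (simp add: v_def)
    have sub: "{z. - c + z \<in> S -` cbox (-v) v} \<subseteq> {z. dist z c < \<delta> \<and> (\<forall>j\<in>J. \<bar>f j \<bullet> (z - c)\<bar> \<le> h j)}"
    proof (rule subsetI, rule CollectI, intro conjI ballI)
      fix z assume "z \<in> {z. - c + z \<in> S -` cbox (-v) v}"
      then have z: "\<bar>S (z - c) \<bullet> b\<bar> \<le> t * g b" if "b \<in> Basis" for b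
        using that v[OF that] by (auto simp: mem_box abs_le_iff)
      have "norm (S (z - c)) \<le> (\<Sum>b\<in>Basis. \<bar>S (z - c) \<bullet> b\<bar>)"
        by (rule norm_le_l1)
      also have "\<dots> \<le> (\<Sum>b\<in>(Basis::'a set). t)"
        using z g t by (intro sum_mono) (meson mult_left_le less_imp_le order_trans)
      finally have "B * norm (z - c) < B * \<delta>"
        using B(2)[of "z - c"] t(3) by simp
      then show "dist z c < \<delta>" using B(1) by (simp add: dist_norm)
      fix j assume j: "j \<in> J"
      have "\<bar>f j \<bullet> (z - c)\<bar> \<le> t * h j"
        using z[of "\<phi> j"] j S(4,5) g\<phi> by auto
      also have "\<dots> \<le> h j" using t h[OF j] by (simp add: mult_left_le_one_le)
      finally show "\<bar>f j \<bullet> (z - c)\<bar> \<le> h j" .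
    qed
    have "(\<Prod>b\<in>Basis. g b) = (\<Prod>b\<in>\<phi> ` J. g b)"
      using S(4) by (intro prod.mono_neutral_right) (auto simp: g_def)
    also have "\<dots> = (\<Prod>j\<in>J. h j)"
      using S(3) g\<phi> by (simp add: prod.reindex)
    finally have gh: "(\<Prod>b\<in>Basis. g b) = (\<Prod>j\<in>J. h j)" .
    have "emeasure lborel {z. - c + z \<in> S -` cbox (-v) v} = emeasure lborel (S -` cbox (-v) v)"
      by (rule emeasure_lborel_translate) (metis \<open>S \<in> borel_measurable borel\<close> borel_closed closed_cbox measurable_sets_borel)
    also have "\<dots> = (\<integral>\<^sup>+z. indicator (cbox (-v) v) (S z) \<partial>lborel)"
    proof -
      have "S -` cbox (-v) v \<in> sets borel"
        by (metis \<open>S \<in> borel_measurable borel\<close> borel_closed closed_cbox measurable_sets_borel)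
      moreover have "indicator (cbox (-v) v) (S z) = (indicator (S -` cbox (-v) v) z :: ennreal)" for z
        by (simp add: indicator_def)
      ultimately show ?thesis by simp
    qed
    also have "\<dots> = ennreal k * emeasure lborel (cbox (-v) v)"
      by (subst k(2)) auto
    also have "emeasure lborel (cbox (-v) v) = ennreal (\<Prod>b\<in>Basis. (v - (-v)) \<bullet> b)"
      using t(1) g(1) v by (intro emeasure_lborel_cbox) simp
    also have "(\<Prod>b\<in>Basis. (v - (-v)) \<bullet> b) = (\<Prod>b\<in>(Basis::'a set). (2 * t) * g b)"
      by (intro prod.cong) (auto simp: v inner_add_left)
    also have "\<dots> = (2 * t) ^ DIM('a) * (\<Prod>j\<in>J. h j)"
      by (simp add: prod.distrib gh power_mult_distrib)
    also have "ennreal k * ennreal \<dots> = ennreal (\<kappa> * (\<Prod>j\<in>J. h j))"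
      using k(1) by (simp add: \<kappa>_def ennreal_mult'[symmetric] mult.assoc)
    finally have "ennreal (\<kappa> * (\<Prod>j\<in>J. h j)) = emeasure lborel {z. - c + z \<in> S -` cbox (-v) v}" ..
    also have "\<dots> \<le> emeasure lborel {z. dist z c < \<delta> \<and> (\<forall>j\<in>J. \<bar>f j \<bullet> (z - c)\<bar> \<le> h j)}"
    proof (rule emeasure_mono[OF sub])
      have "{z. dist z c < \<delta> \<and> (\<forall>j\<in>J. \<bar>f j \<bullet> (z - c)\<bar> \<le> h j)} =
          {z \<in> space borel. dist z c < \<delta> \<and> (\<forall>j\<in>J. \<bar>f j \<bullet> (z - c)\<bar> \<le> h j)}" by simp
      also have "\<dots> \<in> sets borel" using finJ by measurable
      finally show "{z. dist z c < \<delta> \<and> (\<forall>j\<in>J. \<bar>f j \<bullet> (z - c)\<bar> \<le> h j)} \<in> sets lborel" by simp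
    qed
    finally show ?thesis .
  qed
  have "\<kappa> > 0" using k t by (simp add: \<kappa>_def)
  then show thesis using main by (rule that)
qed

text \<open>The integral reduces to that of \<open>s powr -\<alpha>\<close> over an interval
  starting at 0, where \<alpha> < 1 makes the singularity integrable.\<close>

lemma nn_integral_abs_powr_finite:
  fixes \<alpha> \<beta> R :: real
  assumes "\<alpha> < 1"
  shows "(\<integral>\<^sup>+s. indicator {-R..R} s * ennreal (\<bar>s - \<beta>\<bar> powr -\<alpha>) \<partial>lborel) < \<infinity>"
proof -
  define M where "M = \<bar>R\<bar> + \<bar>\<beta>\<bar>"
  define g :: "real \<Rightarrow> ennreal" where "g s = indicator {0..M} s * ennreal (s powr -\<alpha>)" for s
  have [measurable]: "g \<in> borel_measurable borel" unfolding g_def by measurable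
  have "((\<lambda>x. x powr -\<alpha>) has_integral (M powr (-\<alpha>+1) / (-\<alpha>+1))) {0..M}"
    using assms by (intro has_integral_powr_from_0) (auto simp: M_def)
  then have "(\<integral>\<^sup>+s. ennreal (s powr -\<alpha>) * indicator {0..M} s \<partial>lborel) = ennreal (M powr (-\<alpha>+1) / (-\<alpha>+1))"
    by (rule nn_integral_has_integral_lebesgue'[rotated]) simp
  then have g: "(\<integral>\<^sup>+s. g s \<partial>lborel) < \<infinity>"
    by (simp add: g_def mult.commute)
  \<comment> \<open>Symmetrising \<open>g\<close> takes care of both signs of
    \<open>s - \<beta>\<close>; \<open>M\<close> bounds that difference for \<open>s\<close> in the
    interval.\<close>
  define h where "h s = g s + g (0 - s)" for s
  have [measurable]: "h \<in> borel_measurable borel" unfolding h_def by measurable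
  have h: "(\<integral>\<^sup>+s. h s \<partial>lborel) < \<infinity>"
  proof -
    have "(\<integral>\<^sup>+s. h s \<partial>lborel) = (\<integral>\<^sup>+s. g s \<partial>lborel) + (\<integral>\<^sup>+s. g (0 - s) \<partial>lborel)"
      unfolding h_def by (rule nn_integral_add) auto
    also have "(\<integral>\<^sup>+s. g (0 - s) \<partial>lborel) = (\<integral>\<^sup>+s. g s \<partial>lborel)"
      by (rule nn_integral_lborel_reflect) auto
    finally show ?thesis using g by (simp add: ennreal_add_eq_top less_top)
  qed
  have "(\<integral>\<^sup>+s. indicator {-R..R} s * ennreal (\<bar>s - \<beta>\<bar> powr -\<alpha>) \<partial>lborel) \<le> (\<integral>\<^sup>+s. h (\<beta> - s) \<partial>lborel)"
    by (intro nn_integral_mono) (auto simp: h_def g_def M_def indicator_def abs_if)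
  also have "\<dots> = (\<integral>\<^sup>+s. h s \<partial>lborel)"
    by (rule nn_integral_lborel_reflect) auto
  finally show ?thesis using h by (rule le_less_trans)
qed

text \<open>A linear change of variables turns the factors into functions of distinct coordinates.
  Enlarging the ball to a box then dominates the integral by a product of one-dimensional
  integrals.\<close>

lemma nn_integral_prod_abs_powr_finite:
  fixes f :: "'i \<Rightarrow> 'a::euclidean_space"
  assumes inj: "inj_on f J" and ind: "independent (f ` J)" and \<alpha>: "\<alpha> < 1"
  shows "(\<integral>\<^sup>+z. indicator (cball x r) z * (\<Prod>j\<in>J. ennreal (\<bar>f j \<bullet> z - b j\<bar> powr -\<alpha>)) \<partial>lborel) < \<infinity>"
proof -
  obtain S :: "'a \<Rightarrow> 'a" and \<phi> where S: "linear S" "bij S" "inj_on \<phi> J" "\<phi> ` J \<subseteq> Basis"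
    "\<And>j z. j \<in> J \<Longrightarrow> S z \<bullet> \<phi> j = f j \<bullet> z"
    by (rule linear_coordinates_extend[OF inj ind]) (rule that)
  obtain k where k: "k > 0"
    "\<And>f. f \<in> borel_measurable borel \<Longrightarrow> (\<integral>\<^sup>+z. f (S z) \<partial>lborel) = ennreal k * (\<integral>\<^sup>+z. f z \<partial>lborel)"
    by (rule nn_integral_lborel_linear[OF S(1,2)]) (rule that)
  have "bounded (S ` cball x r)"
    using S(1) by (intro bounded_linear_image) (auto simp: linear_conv_bounded_linear)
  then obtain R where R: "\<And>z. z \<in> cball x r \<Longrightarrow> norm (S z) \<le> R"
    by (auto simp: bounded_iff simp del: mem_cball)
  define \<psi> :: "'a \<Rightarrow> real \<Rightarrow> ennreal" where
    "\<psi> e s = indicator {-R..R} s * (if e \<in> \<phi> ` J then ennreal (\<bar>s - b (inv_into J \<phi> e)\<bar> powr -\<alpha>) else 1)" for e s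
  have [measurable]: "\<psi> e \<in> borel_measurable borel" for e
    unfolding \<psi>_def by measurable
  have "(\<integral>\<^sup>+z. indicator (cball x r) z * (\<Prod>j\<in>J. ennreal (\<bar>f j \<bullet> z - b j\<bar> powr -\<alpha>)) \<partial>lborel)
      \<le> (\<integral>\<^sup>+z. (\<Prod>e\<in>Basis. \<psi> e (S z \<bullet> e)) \<partial>lborel)"
  proof (rule nn_integral_mono)
    fix z
    show "indicator (cball x r) z * (\<Prod>j\<in>J. ennreal (\<bar>f j \<bullet> z - b j\<bar> powr -\<alpha>)) \<le> (\<Prod>e\<in>Basis. \<psi> e (S z \<bullet> e))"
    proof (cases "z \<in> cball x r")
      case True
      have ind1: "- R \<le> S z \<bullet> e \<and> S z \<bullet> e \<le> R" if "e \<in> Basis" for e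
        using Basis_le_norm[OF that, of "S z"] R[OF True] by linarith
      have "(\<Prod>e\<in>Basis. \<psi> e (S z \<bullet> e)) = (\<Prod>e\<in>\<phi> ` J. \<psi> e (S z \<bullet> e))"
        using S(4) ind1 by (intro prod.mono_neutral_right) (auto simp: \<psi>_def indicator_def abs_le_iff)
      also have "\<dots> = (\<Prod>j\<in>J. \<psi> (\<phi> j) (S z \<bullet> \<phi> j))"
        using S(3) by (simp add: prod.reindex)
      also have "\<dots> = (\<Prod>j\<in>J. ennreal (\<bar>f j \<bullet> z - b j\<bar> powr -\<alpha>))"
      proof (rule prod.cong)
        fix j assume j: "j \<in> J"
        then have "\<phi> j \<in> Basis" using S(4) by auto
        from ind1[OF this] S(3,5) j show "\<psi> (\<phi> j) (S z \<bullet> \<phi> j) = ennreal (\<bar>f j \<bullet> z - b j\<bar> powr -\<alpha>)"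
          by (auto simp: \<psi>_def indicator_def abs_le_iff)
      qed simp
      finally show ?thesis using True by simp
    qed simp
  qed
  also have "\<dots> = ennreal k * (\<integral>\<^sup>+z. (\<Prod>e\<in>Basis. \<psi> e (z \<bullet> e)) \<partial>lborel)"
    by (rule k(2)) measurable
  also have "(\<integral>\<^sup>+z. (\<Prod>e\<in>(Basis::'a set). \<psi> e (z \<bullet> e)) \<partial>lborel) = (\<Prod>e\<in>Basis. integral\<^sup>N lborel (\<psi> e))"
    by (rule nn_integral_lborel_prod) auto
  also have "ennreal k * \<dots> < \<infinity>"
  proof -
    have "integral\<^sup>N lborel (\<psi> e) < \<infinity>" for e
    proof (cases "e \<in> \<phi> ` J")
      case True
      then show ?thesis
        using nn_integral_abs_powr_finite[OF \<alpha>, of R "b (inv_into J \<phi> e)"]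
        by (simp add: \<psi>_def[abs_def])
    next
      case False
      then show ?thesis
        by (simp add: \<psi>_def[abs_def] emeasure_lborel_Icc_eq)
    qed
    then have "(\<Prod>e\<in>(Basis::'a set). integral\<^sup>N lborel (\<psi> e)) \<noteq> \<infinity>"
      by (auto simp: ennreal_prod_eq_top less_top)
    then show ?thesis by (simp add: ennreal_mult_less_top less_top)
  qed
  finally show ?thesis .
qed

section \<open>Facets of a simple polytope\<close>

lemma facet_eqn_spec:
  fixes P :: "'a::euclidean_space set"
  assumes P: "interior P \<noteq> {}" and F: "F facet_of P"
  shows "norm (fst (facet_eqn F)) = 1"
    and "affine hull F = {x. fst (facet_eqn F) \<bullet> x = snd (facet_eqn F)}"
proof -
  have "aff_dim F = int (DIM('a) - 1)"
    using F aff_dim_nonempty_interior[OF P] DIM_positive[where 'a='a]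
    by (simp add: facet_of_def of_nat_diff)
  then obtain a b where ab: "a \<noteq> 0" "affine hull F = {x. a \<bullet> x = b}"
    using aff_dim_eq_hyperplane by blast
  have "affine hull F = {x. (a /\<^sub>R norm a) \<bullet> x = b / norm a}"
    using ab by (auto simp: field_simps)
  then have "\<exists>p. case p of (a, b) \<Rightarrow> norm a = 1 \<and> affine hull F = {x. a \<bullet> x = b}"
    using ab(1) by (intro exI[of _ "(a /\<^sub>R norm a, b / norm a)"]) auto
  from someI_ex[OF this]
  show "norm (fst (facet_eqn F)) = 1"
    and "affine hull F = {x. fst (facet_eqn F) \<bullet> x = snd (facet_eqn F)}"
    by (auto simp: facet_eqn_def case_prod_unfold)
qed

section \<open>Inward normals, levels and the facets through a point\<close>

locale simple_polytope_geometry =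
  fixes P :: "'a::euclidean_space set"
  assumes simple: "simple_polytope P"
begin

lemma polyhedron_P: "polyhedron P" and compact_P: "compact P" and interior_P: "interior P \<noteq> {}"
  and card_facets_vertex: "{v} face_of P \<Longrightarrow> card {F. F facet_of P \<and> v \<in> F} = DIM('a)"
  using simple by (auto simp: simple_polytope_def)

lemma convex_P: "convex P" and closed_P: "closed P" and bounded_P: "bounded P"
  using polyhedron_P compact_P by (auto simp: polyhedron_imp_convex compact_imp_closed compact_imp_bounded)

lemma finite_facets: "finite {F. F facet_of P}"
  using polyhedron_P by (rule finite_polyhedron_facets)

text \<open>\<open>facet_eqn\<close> fixes a unit normal only up to sign. This predicate tells
  whether the chosen one points into \<open>P\<close>; \<open>nrm\<close> and \<open>off\<close>
  reverse it otherwise, so that \<open>lev F\<close> measures the distance to the hyperplane of the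
  facet \<open>F\<close> from within \<open>P\<close>.\<close>

definition inner_side :: "'a set \<Rightarrow> bool" where
  "inner_side F \<longleftrightarrow> P \<subseteq> {x. snd (facet_eqn F) \<le> fst (facet_eqn F) \<bullet> x}"

definition nrm :: "'a set \<Rightarrow> 'a" where
  "nrm F = (if inner_side F then fst (facet_eqn F) else - fst (facet_eqn F))"

definition off :: "'a set \<Rightarrow> real" where
  "off F = (if inner_side F then snd (facet_eqn F) else - snd (facet_eqn F))"

definition lev :: "'a set \<Rightarrow> 'a \<Rightarrow> real" where
  "lev F z = nrm F \<bullet> z - off F"

definition act :: "'a \<Rightarrow> 'a set set" where
  "act x = {F. F facet_of P \<and> x \<in> F}"

lemma facet_eqn_nrm: "fst (facet_eqn F) = nrm F \<or> fst (facet_eqn F) = - nrm F"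
  by (simp add: nrm_def)

lemma facet_eqn_lev:
  "fst (facet_eqn F) \<bullet> z = snd (facet_eqn F) \<longleftrightarrow> lev F z = 0"
  by (auto simp: lev_def nrm_def off_def)

lemma finite_act: "finite (act x)"
  using finite_facets by (rule finite_subset[rotated]) (auto simp: act_def)

lemma lev_diff: "lev F z = lev F w + nrm F \<bullet> (z - w)"
  by (simp add: lev_def inner_diff_right)

lemma lev_affine: "lev F ((1 - t) *\<^sub>R x + t *\<^sub>R y) = (1 - t) * lev F x + t * lev F y"
  by (simp add: lev_def inner_add_right algebra_simps)

lemma continuous_lev: "continuous_on S (lev F)"
  unfolding lev_def by (intro continuous_intros)

context
  fixes F assumes F: "F facet_of P"
begin

lemma norm_nrm: "norm (nrm F) = 1"
  using facet_eqn_spec(1)[OF interior_P F] by (simp add: nrm_def)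

lemma lev_lipschitz: "\<bar>lev F z - lev F w\<bar> \<le> dist z w"
  using Cauchy_Schwarz_ineq2[of "nrm F" "z - w"] norm_nrm lev_diff[of F z w] by (simp add: dist_norm)

lemma facet_eq: "F = {z \<in> P. lev F z = 0}"
proof -
  have "F face_of P" using F by (simp add: facet_of_def)
  then have "F = affine hull F \<inter> P" by (rule face_of_imp_eq_affine_Int[OF convex_P])
  then show ?thesis
    unfolding facet_eqn_spec(2)[OF interior_P F] by (auto simp: facet_eqn_lev)
qed

lemma lev_interior_nonzero: "x \<in> interior P \<Longrightarrow> lev F x \<noteq> 0"
proof -
  assume x: "x \<in> interior P"
  have "F face_of P" "F \<noteq> P" using F by (auto simp: facet_of_def)
  then have "affine hull F \<inter> rel_interior P = {}" by (rule affine_hull_face_of_disjoint_rel_interior[OF convex_P])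
  then show ?thesis using x
    by (auto simp: facet_eqn_spec(2)[OF interior_P F] facet_eqn_lev rel_interior_nonempty_interior[OF interior_P])
qed

text \<open>The interior of \<open>P\<close> is connected and misses the hyperplane of the facet,
  hence lies on one side of it, and \<open>P\<close> is the closure of its interior. The sign
  convention of \<open>nrm\<close> does the rest.\<close>

lemma lev_nonneg: "x \<in> P \<Longrightarrow> lev F x \<ge> 0"
proof -
  assume x: "x \<in> P"
  define a b where "a = fst (facet_eqn F)" and "b = snd (facet_eqn F)"
  have nz: "a \<bullet> y - b \<noteq> 0" if "y \<in> interior P" for y
    using lev_interior_nonzero[OF that] facet_eqn_lev[of F y] by (simp add: a_def b_def)
  have conn: "connected ((\<lambda>y. a \<bullet> y - b) ` interior P)"
    by (intro connected_continuous_image continuous_intros convex_connected convex_interior convex_P)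
  have cl: "P = closure (interior P)"
    using convex_closure_interior[OF convex_P interior_P] closed_P by simp
  have "(\<forall>y\<in>interior P. a \<bullet> y - b \<ge> 0) \<or> (\<forall>y\<in>interior P. a \<bullet> y - b \<le> 0)"
  proof (rule ccontr)
    assume "\<not> ?thesis"
    then obtain y z where "y \<in> interior P" "a \<bullet> y - b < 0" "z \<in> interior P" "a \<bullet> z - b > 0" by (meson not_le)
    then have "0 \<in> (\<lambda>y. a \<bullet> y - b) ` interior P"
      using connectedD_interval[OF conn, of "a \<bullet> y - b" "a \<bullet> z - b" 0] by auto
    then show False using nz by auto
  qed
  then show ?thesis
  proof
    assume *: "\<forall>y\<in>interior P. a \<bullet> y - b \<ge> 0"
    have "P \<subseteq> {y. b \<le> a \<bullet> y}"
      by (subst cl, rule closure_minimal) (use * closed_halfspace_ge[of b a] in auto)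
    then show ?thesis using x by (auto simp: lev_def nrm_def off_def inner_side_def a_def b_def)
  next
    assume *: "\<forall>y\<in>interior P. a \<bullet> y - b \<le> 0"
    have "P \<subseteq> {y. a \<bullet> y \<le> b}"
      by (subst cl, rule closure_minimal) (use * closed_halfspace_le[of a b] in auto)
    then show ?thesis using x by (auto simp: lev_def nrm_def off_def inner_side_def a_def b_def)
  qed
qed

lemma lev_pos: "x \<in> P \<Longrightarrow> x \<notin> F \<Longrightarrow> lev F x > 0"
  using lev_nonneg[of x] facet_eq by force

lemma closed_facet: "closed F"
  using F by (intro face_of_imp_closed[OF convex_P closed_P] facet_of_imp_face_of)

end

text \<open>A segment from an interior point to a point outside \<open>P\<close> crosses some facet
  at \<open>y\<close>. The level of that facet is affine along the segment, positive at the start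
  and zero at \<open>y\<close> before the end, so it cannot be nonnegative at the end.\<close>

lemma P_eq: "P = {z. \<forall>F. F facet_of P \<longrightarrow> lev F z \<ge> 0}"
proof (intro equalityI subsetI)
  fix z assume z: "z \<in> {z. \<forall>F. F facet_of P \<longrightarrow> lev F z \<ge> 0}"
  show "z \<in> P"
  proof (rule ccontr)
    assume zP: "z \<notin> P"
    obtain b where b: "b \<in> interior P" using interior_P by auto
    then have "b \<in> P" using interior_subset by auto
    then have "closed_segment b z \<inter> frontier P \<noteq> {}"
      using zP by (intro connected_Int_frontier) auto
    then obtain y where y: "y \<in> closed_segment b z" "y \<in> frontier P" by auto
    have "y \<in> P - rel_interior P"
      using y(2) closed_P interior_P by (simp add: frontier_def rel_interior_nonempty_interior)
    then obtain F where F: "F facet_of P" "y \<in> F"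
      using rel_boundary_of_polyhedron[OF polyhedron_P] by auto
    obtain t where t: "0 \<le> t" "t \<le> 1" "y = (1 - t) *\<^sub>R b + t *\<^sub>R z"
      using y(1) by (auto simp: closed_segment_def)
    have "lev F y = 0" using F facet_eq by auto
    moreover have "lev F b > 0" using lev_nonneg[OF F(1) \<open>b \<in> P\<close>] lev_interior_nonzero[OF F(1) b] by simp
    moreover have "lev F z \<ge> 0" using z F by auto
    moreover have "t \<noteq> 1" using t(3) F zP facet_of_imp_subset[OF F(1)] by auto
    ultimately have "(1 - t) * lev F b > 0" "t * lev F z \<ge> 0" "lev F y = 0"
      using t by (auto intro!: mult_pos_pos)
    then show False using lev_affine[of F t b z] t(3) by simp
  qed
qed (auto simp: lev_nonneg)

text \<open>Facets that miss \<open>x0\<close> have levels bounded away from 0 near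
  \<open>x0\<close>, so only the facets through \<open>x0\<close> constrain nearby points.\<close>

lemma locally_cone:
  assumes x0: "x0 \<in> P"
  obtains \<rho> where "\<rho> > 0"
    "\<And>z. dist z x0 < \<rho> \<Longrightarrow> (\<And>F. F \<in> act x0 \<Longrightarrow> lev F z \<ge> 0) \<Longrightarrow> z \<in> P"
proof -
  let ?N = "{F. F facet_of P \<and> x0 \<notin> F}"
  have fin: "finite ?N" using finite_facets by (rule finite_subset[rotated]) auto
  \<comment> \<open>Half the least level of a facet missing \<open>x0\<close>: levels are
    1-Lipschitz, so they stay positive within this radius. The inserted 1 covers the case that no
    facet misses \<open>x0\<close>.\<close>
  define \<rho> where "\<rho> = Min (insert 1 ((\<lambda>F. lev F x0) ` ?N)) / 2"
  have "Min (insert 1 ((\<lambda>F. lev F x0) ` ?N)) > 0"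
    using fin lev_pos[OF _ x0] by (subst Min_gr_iff) auto
  then have \<rho>: "\<rho> > 0" by (simp add: \<rho>_def)
  have 1: "lev F z > \<rho>" if "dist z x0 < \<rho>" "F facet_of P" "x0 \<notin> F" for z F
  proof -
    have "2 * \<rho> \<le> lev F x0"
      using fin that(2,3) by (auto simp: \<rho>_def intro!: Min_le)
    then show ?thesis using lev_lipschitz[OF that(2), of z x0] that(1) by linarith
  qed
  have "z \<in> P" if "dist z x0 < \<rho>" "\<And>F. F \<in> act x0 \<Longrightarrow> lev F z \<ge> 0" for z
  proof (subst P_eq, safe)
    fix F assume F: "F facet_of P"
    show "lev F z \<ge> 0"
      using 1[OF that(1) F] that(2)[of F] \<rho> F by (cases "x0 \<in> F") (auto simp: act_def)
  qed
  with \<rho> show thesis by (rule that)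
qed

text \<open>Simplicity enters here. The facets through \<open>x0\<close> all pass through some
  vertex \<open>v\<close>. The normals at \<open>v\<close> span, since along a vector orthogonal to
  all of them one could move from \<open>v\<close> in both directions inside \<open>P\<close>. As
  there are exactly \<open>DIM('a)\<close> facets at \<open>v\<close>, spanning forces independence,
  which passes to the subfamily at \<open>x0\<close>.\<close>

lemma act_independent:
  assumes x0: "x0 \<in> P"
  shows "inj_on nrm (act x0)" "independent (nrm ` act x0)" "card (act x0) \<le> DIM('a)"
proof -
  have "\<exists>v. {v} face_of P \<and> act x0 \<subseteq> act v"
  proof -
    \<comment> \<open>An intersection over no facets would be the whole space, so \<open>P\<close>
      itself replaces it.\<close>
    define G where "G = (if act x0 = {} then P else \<Inter>(act x0))"
    have G: "G face_of P"
      using convex_P by (auto simp: G_def face_of_refl act_def facet_of_def intro!: face_of_Inter)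
    have "x0 \<in> G" using x0 by (auto simp: G_def act_def)
    moreover have "compact G" using G compact_P convex_P face_of_imp_compact by blast
    moreover have "convex G" using G face_of_imp_convex by blast
    ultimately obtain v where v: "v extreme_point_of G"
      using extreme_point_exists_convex[of G] by auto
    then have "{v} face_of P" using G by (metis face_of_singleton face_of_trans)
    moreover have "v \<in> G" using v by (simp add: extreme_point_of_def)
    then have "act x0 \<subseteq> act v" by (auto simp: G_def act_def split: if_splits)
    ultimately show ?thesis by auto
  qed
  then obtain v where v: "{v} face_of P" "act x0 \<subseteq> act v" by auto
  have vP: "v \<in> P" using v(1) face_of_imp_subset by auto
  have card: "card (act v) = DIM('a)" using card_facets_vertex[OF v(1)] by (simp add: act_def)
  have "dim (nrm ` act v) = DIM('a)"
  proof (rule ccontr)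
    assume "dim (nrm ` act v) \<noteq> DIM('a)"
    then have "dim (nrm ` act v) < DIM('a)"
      using dim_subset_UNIV[of "nrm ` act v"] by linarith
    then obtain z where z: "z \<noteq> 0" "\<And>y. y \<in> span (nrm ` act v) \<Longrightarrow> orthogonal z y"
      by (rule orthogonal_to_subspace_exists) blast
    then have z0: "nrm F \<bullet> z = 0" if "F \<in> act v" for F
      using that by (metis image_eqI inner_commute orthogonal_def span_base)
    obtain \<rho> where \<rho>: "\<rho> > 0" "\<And>z. dist z v < \<rho> \<Longrightarrow> (\<And>F. F \<in> act v \<Longrightarrow> lev F z \<ge> 0) \<Longrightarrow> z \<in> P"
      using locally_cone[OF vP] by metis
    define e where "e = (\<rho> / (2 * norm z)) *\<^sub>R z"
    have e: "norm e < \<rho>" "e \<noteq> 0" using z(1) \<rho>(1) by (auto simp: e_def)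
    have lv: "lev F v = 0" if "F \<in> act v" for F using that facet_eq by (auto simp: act_def)
    have "v + e \<in> P" "v - e \<in> P"
      using e(1) lv z0 lev_diff[of _ "v + e" v] lev_diff[of _ "v - e" v]
      by (auto intro!: \<rho>(2) simp: dist_norm e_def)
    moreover have "v \<in> open_segment (v - e) (v + e)"
      using e(2) unfolding in_segment
      by (intro conjI exI[of _ "1/2"]) (auto simp: algebra_simps scaleR_2[symmetric] simp flip: scaleR_add_left)
    ultimately show False
      using v(1) by (auto simp: face_of_singleton extreme_point_of_def)
  qed
  moreover have "dim (nrm ` act v) \<le> card (nrm ` act v)" using finite_act by (intro dim_le_card') auto
  moreover have "card (nrm ` act v) \<le> card (act v)" by (rule card_image_le[OF finite_act])
  ultimately have c: "card (nrm ` act v) = card (act v)" "card (nrm ` act v) = dim (nrm ` act v)"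
    using card by auto
  from c(1) have "inj_on nrm (act v)" by (intro eq_card_imp_inj_on finite_act)
  then show "inj_on nrm (act x0)" using v(2) by (rule inj_on_subset)
  have "independent (nrm ` act v)"
    by (rule card_eq_dim[OF subset_refl c(2) finite_imageI[OF finite_act], THEN iffD2, OF span_superset])
  then show "independent (nrm ` act x0)" by (rule independent_mono[OF _ image_mono[OF v(2)]])
  show "card (act x0) \<le> DIM('a)" using card_mono[OF finite_act v(2)] card by simp
qed

text \<open>All directions of \<open>G\<close> are orthogonal to the \<open>card (act x0)\<close>
  independent normals at \<open>x0\<close>.\<close>

lemma aff_dim_le_act:
  assumes x0: "x0 \<in> P" "x0 \<in> G" "\<And>F. F \<in> act x0 \<Longrightarrow> G \<subseteq> F"
  shows "aff_dim G \<le> int DIM('a) - int (card (act x0))"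
proof -
  let ?D = "(+) (- x0) ` G"
  have "x \<bullet> y = 0" if "x \<in> ?D" "y \<in> nrm ` act x0" for x y
  proof -
    obtain g F where g: "g \<in> G" "x = - x0 + g" "F \<in> act x0" "y = nrm F" using \<open>x \<in> ?D\<close> \<open>y \<in> _\<close> by auto
    then have "lev F g = 0" "lev F x0 = 0" using x0 facet_eq[of F] by (auto simp: act_def)
    then show ?thesis using g lev_diff[of F g x0] by (simp add: inner_commute)
  qed
  then have "dim (?D \<union> nrm ` act x0) = dim ?D + dim (nrm ` act x0)" by (rule dim_orthogonal_sum)
  moreover have "dim (nrm ` act x0) = card (act x0)"
    using act_independent[OF x0(1)] by (simp add: dim_eq_card_independent card_image)
  moreover have "dim (?D \<union> nrm ` act x0) \<le> DIM('a)" by (rule dim_subset_UNIV)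
  moreover have "aff_dim G = int (dim ?D)" using x0(2) by (intro aff_dim_eq_dim) (simp add: hull_inc)
  ultimately show ?thesis by simp
qed

text \<open>A facet that meets the relative interior of the face \<open>G\<close> contains all of
  \<open>G\<close>.\<close>

lemma card_act_le_codim:
  assumes "G face_of P" "x \<in> rel_interior G"
  shows "aff_dim G \<le> int DIM('a) - int (card (act x))"
proof (rule aff_dim_le_act)
  show xG: "x \<in> G" using assms rel_interior_subset by auto
  show "x \<in> P" using xG assms(1) face_of_imp_subset by auto
  fix F assume "F \<in> act x"
  then show "G \<subseteq> F"
    using assms face_of_imp_subset[OF assms(1)]
    by (intro subset_of_face_of[of F P G]) (auto simp: act_def facet_of_def)
qed

text \<open>The intersection of two or more facets through \<open>x\<close> would be a face of
  codimension at least 2 containing \<open>x\<close>.\<close>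

lemma card_act_le_1:
  assumes "x \<in> P - boundary2 P"
  shows "card (act x) \<le> 1"
proof (rule ccontr)
  assume c: "\<not> card (act x) \<le> 1"
  then have ne: "act x \<noteq> {}" by auto
  have "\<Inter>(act x) face_of P" using ne by (intro face_of_Inter) (auto simp: act_def facet_of_def)
  moreover have "aff_dim (\<Inter>(act x)) \<le> int DIM('a) - int (card (act x))"
    using assms by (intro aff_dim_le_act) (auto simp: act_def)
  moreover have "x \<in> \<Inter>(act x)" by (auto simp: act_def)
  moreover have "int DIM('a) - int (card (act x)) \<le> int DIM('a) - 2" using c by simp
  ultimately have "x \<in> boundary2 P"
    unfolding boundary2_def by (intro UnionI[of "\<Inter>(act x)"] CollectI conjI) linarith+
  then show False using assms by simp
qed

end

section \<open>Lower semicontinuous convex functions\<close>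

lemma lsc_on_iff:
  "lsc_on S u \<longleftrightarrow> (\<forall>x\<in>S. \<forall>l<u x. eventually (\<lambda>y. l < u y) (at x within S))"
  by (simp add: lsc_on_def le_Liminf_iff)

lemma lsc_onD: "lsc_on S u \<Longrightarrow> x \<in> S \<Longrightarrow> l < u x \<Longrightarrow> eventually (\<lambda>y. l < u y) (at x within S)"
  by (simp add: lsc_on_iff)

lemma lsc_on_SUP:
  assumes "\<And>u. u \<in> A \<Longrightarrow> lsc_on S u"
  shows "lsc_on S (\<lambda>x. SUP u\<in>A. u x)"
  unfolding lsc_on_iff
proof safe
  fix x l assume x: "x \<in> S" "l < (SUP u\<in>A. u x)"
  then obtain u where u: "u \<in> A" "l < u x" by (auto simp: less_SUP_iff)
  from lsc_onD[OF assms[OF u(1)] x(1) u(2)]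
  show "eventually (\<lambda>y. l < (SUP u\<in>A. u y)) (at x within S)"
    by eventually_elim (use u(1) in \<open>auto simp: less_SUP_iff\<close>)
qed

lemma lsc_on_cmult:
  fixes k :: ennreal
  assumes "lsc_on S u" "k \<noteq> 0" "k \<noteq> \<infinity>"
  shows "lsc_on S (\<lambda>x. k * u x)"
  unfolding lsc_on_iff
proof safe
  have iff: "l < k * v \<longleftrightarrow> l / k < v" for l v :: ennreal
    using assms(2,3) by (metis divide_less_ennreal infinity_ennreal_def mult.commute not_gr_zero top.not_eq_extremum)
  fix x l assume "x \<in> S" "l < k * u x"
  then have "l / k < u x" by (simp add: iff)
  from lsc_onD[OF assms(1) \<open>x \<in> S\<close> this] show "eventually (\<lambda>y. l < k * u y) (at x within S)"
    by (simp add: iff)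
qed

lemma closed_sublevel_lsc:
  assumes u: "lsc_on S u" and S: "closed S"
  shows "closed {x\<in>S. u x \<le> l}"
  unfolding closed_limpt
proof (intro allI impI)
  fix x assume x: "x islimpt {x\<in>S. u x \<le> l}"
  then have "x \<in> S" using S islimpt_subset[OF x, of S] by (auto simp: closed_limpt)
  moreover have "u x \<le> l"
  proof (rule ccontr)
    assume "\<not> u x \<le> l"
    then have "eventually (\<lambda>y. l < u y) (at x within S)" using lsc_onD[OF u \<open>x \<in> S\<close>] by simp
    then obtain T where T: "open T" "x \<in> T" "\<And>y. y \<in> T \<Longrightarrow> y \<in> S \<Longrightarrow> y \<noteq> x \<Longrightarrow> l < u y"
      by (auto simp: eventually_at_topological)
    from islimptE[OF x T(2,1)] obtain y where "y \<in> S" "u y \<le> l" "y \<in> T" "y \<noteq> x" by auto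
    then show False using T(3)[of y] by simp
  qed
  ultimately show "x \<in> {x\<in>S. u x \<le> l}" by simp
qed

lemma borel_measurable_lsc_indicator:
  fixes u :: "'a::euclidean_space \<Rightarrow> ennreal"
  assumes u: "lsc_on S u" and S: "closed S"
  shows "(\<lambda>x. u x * indicator S x) \<in> borel_measurable borel"
proof (rule borel_measurableI_le)
  fix l
  have "{x \<in> space borel. u x * indicator S x \<le> l} = {x\<in>S. u x \<le> l} \<union> - S"
    by (auto simp: indicator_def)
  also have "\<dots> \<in> sets borel" using closed_sublevel_lsc[OF u S, of l] S by auto
  finally show "{x \<in> space borel. u x * indicator S x \<le> l} \<in> sets borel" .
qed

section \<open>Convexity with values in the extended half line\<close>

lemma enn_convex_onD:
  "enn_convex_on S u \<Longrightarrow> x \<in> S \<Longrightarrow> y \<in> S \<Longrightarrow> 0 \<le> t \<Longrightarrow> t \<le> 1 \<Longrightarrow>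
    u ((1 - t) *\<^sub>R x + t *\<^sub>R y) \<le> ennreal (1 - t) * u x + ennreal t * u y"
  by (auto simp: enn_convex_on_def)

lemma enn_convex_on_max:
  assumes "enn_convex_on S u" "x \<in> S" "y \<in> S" "0 \<le> t" "t \<le> 1"
  shows "u ((1 - t) *\<^sub>R x + t *\<^sub>R y) \<le> max (u x) (u y)"
proof -
  have "u ((1 - t) *\<^sub>R x + t *\<^sub>R y) \<le> ennreal (1 - t) * u x + ennreal t * u y"
    by (rule enn_convex_onD[OF assms])
  also have "\<dots> \<le> ennreal (1 - t) * max (u x) (u y) + ennreal t * max (u x) (u y)"
    by (intro add_mono mult_left_mono) auto
  also have "\<dots> = ennreal ((1 - t) + t) * max (u x) (u y)"
    using assms by (subst ennreal_plus) (auto simp: distrib_right)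
  finally show ?thesis by simp
qed

lemma enn_convex_on_SUP:
  assumes "\<And>u. u \<in> A \<Longrightarrow> enn_convex_on S u"
  shows "enn_convex_on S (\<lambda>x. SUP u\<in>A. u x)"
  unfolding enn_convex_on_def
proof (intro ballI allI impI SUP_least)
  fix x y u and t :: real assume *: "x \<in> S" "y \<in> S" "0 \<le> t \<and> t \<le> 1" "u \<in> A"
  have "u ((1 - t) *\<^sub>R x + t *\<^sub>R y) \<le> ennreal (1 - t) * u x + ennreal t * u y"
    using * by (intro enn_convex_onD[OF assms]) auto
  also have "\<dots> \<le> ennreal (1 - t) * (SUP u\<in>A. u x) + ennreal t * (SUP u\<in>A. u y)"
    using * by (intro add_mono mult_left_mono SUP_upper) auto
  finally show "u ((1 - t) *\<^sub>R x + t *\<^sub>R y) \<le> \<dots>" .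
qed

lemma enn_convex_on_cmult:
  assumes "enn_convex_on S u"
  shows "enn_convex_on S (\<lambda>x. k * u x)"
  unfolding enn_convex_on_def
proof (intro ballI allI impI)
  fix x y and t :: real assume *: "x \<in> S" "y \<in> S" "0 \<le> t \<and> t \<le> 1"
  have "k * u ((1 - t) *\<^sub>R x + t *\<^sub>R y) \<le> k * (ennreal (1 - t) * u x + ennreal t * u y)"
    using * by (intro mult_left_mono enn_convex_onD[OF assms]) auto
  then show "k * u ((1 - t) *\<^sub>R x + t *\<^sub>R y) \<le> ennreal (1 - t) * (k * u x) + ennreal t * (k * u y)"
    by (simp add: distrib_left mult.left_commute)
qed

section \<open>Facet integrals as volume integrals over slabs\<close>

context simple_polytope_geometry
begin

text \<open>The orthogonal projection onto the hyperplane of \<open>F\<close>. Like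
  \<open>slab\<close>, it is written with \<open>facet_eqn\<close> and not with \<open>nrm\<close>,
  to agree literally with the definition of \<open>facet_lebesgue\<close>.\<close>

definition prj :: "'a set \<Rightarrow> 'a \<Rightarrow> 'a" where
  "prj F z = z - (fst (facet_eqn F) \<bullet> z - snd (facet_eqn F)) *\<^sub>R fst (facet_eqn F)"

definition slab :: "'a set \<Rightarrow> 'a set" where
  "slab F = {z. snd (facet_eqn F) \<le> fst (facet_eqn F) \<bullet> z \<and> fst (facet_eqn F) \<bullet> z \<le> snd (facet_eqn F) + 1}"

lemma sets_slab[measurable]: "slab F \<in> sets borel"
proof -
  have "slab F = {z. snd (facet_eqn F) \<le> fst (facet_eqn F) \<bullet> z} \<inter> {z. fst (facet_eqn F) \<bullet> z \<le> snd (facet_eqn F) + 1}"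
    by (auto simp: slab_def)
  then show ?thesis by (simp add: closed_halfspace_ge closed_halfspace_le)
qed

lemma measurable_prj[measurable]: "prj F \<in> borel_measurable borel"
  unfolding prj_def by measurable

text \<open>Replaces integration over a facet by integration against Lebesgue measure on the full
  space, so that lower bounds on facet integrals follow from lower bounds on volumes.\<close>

lemma nn_integral_facet:
  assumes [measurable]: "(\<lambda>x. u x * indicator F x) \<in> borel_measurable borel"
  shows "(\<integral>\<^sup>+x\<in>F. u x \<partial>facet_lebesgue F) = (\<integral>\<^sup>+z. indicator (slab F) z * (u (prj F z) * indicator F (prj F z)) \<partial>lborel)"
proof -
  have [measurable]: "(\<lambda>z. u (prj F z) * indicator F (prj F z)) \<in> borel_measurable borel"
    using measurable_compose[OF measurable_prj assms] .
  have eq: "facet_lebesgue F = distr (density lborel (indicator (slab F))) borel (prj F)"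
    unfolding facet_lebesgue_def hyperplane_lebesgue_def slab_def prj_def ..
  show ?thesis
    unfolding eq by (subst nn_integral_distr, simp_all, subst nn_integral_density) auto
qed

lemma lsc_facet_measurable:
  assumes "lsc_on P u" "F facet_of P"
  shows "(\<lambda>x. u x * indicator F x) \<in> borel_measurable borel"
proof -
  have [measurable]: "F \<in> sets borel" using closed_facet[OF assms(2)] by simp
  have [measurable]: "(\<lambda>x. u x * indicator P x) \<in> borel_measurable borel"
    by (rule borel_measurable_lsc_indicator[OF assms(1) closed_P])
  have "(\<lambda>x. u x * indicator F x) = (\<lambda>x. (u x * indicator P x) * indicator F x)"
    using facet_of_imp_subset[OF assms(2)] by (auto simp: indicator_def fun_eq_iff)
  also have "\<dots> \<in> borel_measurable borel" by measurable
  finally show ?thesis .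
qed

lemma facet_le_boundary_integral:
  assumes "F facet_of P"
  shows "ennreal (c F) * (\<integral>\<^sup>+x\<in>F. u x \<partial>facet_lebesgue F) \<le> boundary_integral P c u"
  unfolding boundary_integral_def
  using assms finite_facets by (intro member_le_sum[where f="\<lambda>F. ennreal (c F) * (\<integral>\<^sup>+x\<in>F. u x \<partial>facet_lebesgue F)"]) auto

lemma boundary_integral_cmult:
  assumes "lsc_on P u"
  shows "boundary_integral P c (\<lambda>x. k * u x) = k * boundary_integral P c u"
  unfolding boundary_integral_def sum_distrib_left
proof (rule sum.cong)
  fix F assume "F \<in> {F. F facet_of P}"
  then have F: "F facet_of P" by simp
  have m[measurable]: "(\<lambda>x. u x * indicator F x) \<in> borel_measurable borel"
    by (rule lsc_facet_measurable[OF assms F])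
  have "(\<integral>\<^sup>+x\<in>F. k * u x \<partial>facet_lebesgue F) = (\<integral>\<^sup>+x. k * (u x * indicator F x) \<partial>facet_lebesgue F)"
    by (simp add: mult.assoc)
  also have "\<dots> = k * (\<integral>\<^sup>+x\<in>F. u x \<partial>facet_lebesgue F)"
    by (rule nn_integral_cmult) (simp add: facet_lebesgue_def hyperplane_lebesgue_def)
  finally show "ennreal (c F) * (\<integral>\<^sup>+x\<in>F. k * u x \<partial>facet_lebesgue F) = k * (ennreal (c F) * (\<integral>\<^sup>+x\<in>F. u x \<partial>facet_lebesgue F))"
    by (simp add: mult.left_commute)
qed simp

text \<open>The part of the slab that projects into \<open>F\<close> is bounded, because
  \<open>P\<close> is bounded and the slab has thickness 1. Hence small positive constants will be
  admissible competitors.\<close>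

lemma boundary_integral_const_finite: "boundary_integral P c (\<lambda>_. 1) < \<infinity>"
  unfolding boundary_integral_def infinity_ennreal_def
proof (subst ennreal_sum_less_top[OF finite_facets], safe)
  fix F assume F: "F facet_of P"
  have [measurable]: "F \<in> sets borel" using closed_facet[OF F] by simp
  let ?a = "fst (facet_eqn F)" and ?b = "snd (facet_eqn F)"
  obtain R where R: "\<And>x. x \<in> P \<Longrightarrow> norm x \<le> R" using bounded_P by (auto simp: bounded_iff)
  have "(\<integral>\<^sup>+x\<in>F. 1 \<partial>facet_lebesgue F) = (\<integral>\<^sup>+z. indicator (slab F) z * (1 * indicator F (prj F z)) \<partial>lborel)"
    by (rule nn_integral_facet) simp
  also have "\<dots> \<le> (\<integral>\<^sup>+z. indicator (cball (0::'a) (R + 1)) z \<partial>lborel)"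
  proof (rule nn_integral_mono)
    fix z
    have "norm z \<le> R + 1" if "z \<in> slab F" "prj F z \<in> F"
    proof -
      have "norm z \<le> norm (prj F z) + norm ((?a \<bullet> z - ?b) *\<^sub>R ?a)"
        using norm_triangle_ineq[of "prj F z" "(?a \<bullet> z - ?b) *\<^sub>R ?a"] by (simp add: prj_def)
      also have "norm ((?a \<bullet> z - ?b) *\<^sub>R ?a) \<le> 1"
        using that(1) facet_eqn_spec(1)[OF interior_P F] by (simp add: slab_def)
      also have "norm (prj F z) \<le> R" using that(2) F facet_of_imp_subset R by blast
      finally show ?thesis by simp
    qed
    then show "indicator (slab F) z * (1 * indicator F (prj F z)) \<le> (indicator (cball (0::'a) (R + 1)) z :: ennreal)"
      by (auto simp: indicator_def)
  qed
  also have "\<dots> < top" by (simp add: emeasure_bounded_finite less_top[symmetric] flip: infinity_ennreal_def)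
  finally show "ennreal (c F) * (\<integral>\<^sup>+x\<in>F. 1 \<partial>facet_lebesgue F) < top"
    by (simp add: ennreal_mult_less_top)
qed

end

section \<open>Bounds by the boundary integral\<close>

lemma norm_orthogonal_component_le:
  fixes a w :: "'a::real_inner"
  assumes "norm a = 1"
  shows "norm (w - (a \<bullet> w) *\<^sub>R a) \<le> norm w"
proof (rule norm_le[THEN iffD2])
  have "a \<bullet> a = 1" using assms by (simp add: norm_eq_1)
  then have "(w - (a \<bullet> w) *\<^sub>R a) \<bullet> (w - (a \<bullet> w) *\<^sub>R a) = w \<bullet> w - (a \<bullet> w)\<^sup>2"
    by (simp add: inner_diff_left inner_diff_right inner_commute power2_eq_square algebra_simps)
  then show "(w - (a \<bullet> w) *\<^sub>R a) \<bullet> (w - (a \<bullet> w) *\<^sub>R a) \<le> w \<bullet> w" by simp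
qed

section \<open>Bounds at points on a facet and at points with a fixed ball inside
  \<open>P\<close>\<close>

locale weighted_simple_polytope = simple_polytope_geometry P
  for P :: "'a::euclidean_space set" +
  fixes c :: "'a set \<Rightarrow> real"
  assumes weight_pos: "F facet_of P \<Longrightarrow> c F > 0"
begin

abbreviation BI :: "('a \<Rightarrow> ennreal) \<Rightarrow> ennreal" where "BI \<equiv> boundary_integral P c"

text \<open>The point \<open>p\<close> is the midpoint of the fibre over \<open>x\<close> of the projection of the slab that
  defines the measure of the facet.\<close>
lemma prj_centre:
  assumes F: "F facet_of P" and x: "x \<in> F"
  defines "a \<equiv> fst (facet_eqn F)"
  defines "p \<equiv> x + (1/2) *\<^sub>R a"
  shows "prj F z - x = (z - p) - (a \<bullet> (z - p)) *\<^sub>R a"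
    and "norm (prj F z - x) \<le> dist z p"
    and "lev F (prj F z) = 0"
    and "\<bar>a \<bullet> (z - p)\<bar> \<le> 1/2 \<Longrightarrow> z \<in> slab F"
proof -
  define b where "b = snd (facet_eqn F)"
  have a: "norm a = 1" unfolding a_def by (rule facet_eqn_spec(1)[OF interior_P F])
  then have aa: "a \<bullet> a = 1" by (simp add: norm_eq_1)
  have ax: "a \<bullet> x = b" using facet_eqn_lev[of F x] facet_eq[OF F] x by (auto simp: a_def b_def)
  have az: "a \<bullet> z - b = 1/2 + a \<bullet> (z - p)"
    by (simp add: p_def inner_diff_right inner_add_right aa ax)
  show 1: "prj F z - x = (z - p) - (a \<bullet> (z - p)) *\<^sub>R a"
    unfolding prj_def a_def[symmetric] b_def[symmetric] az
    by (simp add: p_def algebra_simps)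
  show "norm (prj F z - x) \<le> dist z p"
    unfolding 1 dist_norm by (rule norm_orthogonal_component_le[OF a])
  have "a \<bullet> prj F z = b"
    unfolding prj_def a_def[symmetric] b_def[symmetric] by (simp add: inner_diff_right aa)
  then show "lev F (prj F z) = 0" using facet_eqn_lev[of F "prj F z"] by (simp add: a_def b_def)
  show "z \<in> slab F" if "\<bar>a \<bullet> (z - p)\<bar> \<le> 1/2"
    using az that unfolding slab_def a_def[symmetric] b_def[symmetric] mem_Collect_eq by linarith
qed

text \<open>The point \<open>x\<close> may lie on the relative boundary of \<open>F\<close>, so a
  nearby relative interior point \<open>y\<close> takes its place. A small ball in the slab above
  \<open>y\<close> projects into \<open>F\<close> near \<open>x\<close>, and its volume times the
  weight of \<open>F\<close> serves as \<kappa>.\<close>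

lemma boundary_integral_ge_near_facet_point:
  assumes F: "F facet_of P" and x: "x \<in> F" and \<delta>: "\<delta> > 0"
  obtains \<kappa> :: real where "\<kappa> > 0"
    "\<And>u M. lsc_on P u \<Longrightarrow> (\<And>z. z \<in> F \<Longrightarrow> dist z x < \<delta> \<Longrightarrow> M \<le> u z) \<Longrightarrow> ennreal \<kappa> * M \<le> BI u"
proof -
  have "convex F" using F by (meson facet_of_imp_face_of face_of_imp_convex convex_P)
  then have "x \<in> closure (rel_interior F)"
    using x closure_subset[of F] by (auto simp: convex_closure_rel_interior)
  then obtain y where y: "y \<in> rel_interior F" "dist y x < \<delta>"
    using \<delta> by (auto simp: closure_approachable)
  obtain e where e: "e > 0" "y \<in> F" "ball y e \<inter> affine hull F \<subseteq> F"
    using y(1) by (auto simp: mem_rel_interior_ball)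
  \<comment> \<open>The bound 1/2 keeps the ball about \<open>p\<close> in the slab,
    \<open>e\<close> keeps its projection in \<open>F\<close>, and the last term keeps the
    projection within \<delta> of \<open>x\<close>.\<close>
  define \<eta> where "\<eta> = min (1/2) (min e (\<delta> - dist y x))"
  have \<eta>: "\<eta> > 0" "\<eta> \<le> 1/2" "\<eta> \<le> e" "\<eta> \<le> \<delta> - dist y x" using e y unfolding \<eta>_def by linarith+
  let ?a = "fst (facet_eqn F)"
  define p where "p = y + (1/2) *\<^sub>R ?a"
  note prj = prj_centre[OF F e(2), folded p_def]
  define \<kappa> where "\<kappa> = c F * measure lborel (ball p \<eta>)"
  have em: "emeasure lborel (ball p \<eta>) = ennreal (measure lborel (ball p \<eta>))"
    by (rule emeasure_eq_ennreal_measure) (simp add: emeasure_bounded_finite less_imp_neq flip: infinity_ennreal_def)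
  have "emeasure lborel (ball p \<eta>) > 0" using \<eta>(1) by (intro emeasure_lborel_open_pos) auto
  then have "measure lborel (ball p \<eta>) > 0" unfolding em by simp
  then have "\<kappa> > 0" using weight_pos[OF F] by (simp add: \<kappa>_def)
  moreover have "ennreal \<kappa> * M \<le> BI u"
    if u: "lsc_on P u" and M: "\<And>z. z \<in> F \<Longrightarrow> dist z x < \<delta> \<Longrightarrow> M \<le> u z" for u M
  proof -
    have "M * emeasure lborel (ball p \<eta>) = (\<integral>\<^sup>+z. M * indicator (ball p \<eta>) z \<partial>lborel)"
      by (rule nn_integral_cmult_indicator[symmetric]) simp
    also have "\<dots> \<le> (\<integral>\<^sup>+z. indicator (slab F) z * (u (prj F z) * indicator F (prj F z)) \<partial>lborel)"
    proof (rule nn_integral_mono)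
      fix z
      show "M * indicator (ball p \<eta>) z \<le> indicator (slab F) z * (u (prj F z) * indicator F (prj F z))"
      proof (cases "z \<in> ball p \<eta>")
        case True
        then have d: "dist z p < \<eta>" by (simp add: dist_commute)
        have "\<bar>?a \<bullet> (z - p)\<bar> \<le> dist z p"
          using Cauchy_Schwarz_ineq2[of ?a "z - p"] facet_eqn_spec(1)[OF interior_P F] by (simp add: dist_norm)
        then have "z \<in> slab F" using prj(4)[of z] d \<eta>(2) by simp
        moreover have dy: "dist (prj F z) y < \<eta>" using prj(2)[of z] d by (simp add: dist_norm)
        have "prj F z \<in> affine hull F"
          using facet_eqn_spec(2)[OF interior_P F] prj(3)[of z] by (simp add: facet_eqn_lev)
        then have "prj F z \<in> F" using dy \<eta>(3) e(3) by (auto simp: dist_commute)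
        moreover have "dist (prj F z) x < \<delta>"
          using dist_triangle[of "prj F z" x y] dy \<eta>(4) by simp
        ultimately show ?thesis using M[of "prj F z"] True by simp
      qed simp
    qed
    also have "\<dots> = (\<integral>\<^sup>+x\<in>F. u x \<partial>facet_lebesgue F)"
      by (rule nn_integral_facet[symmetric]) (rule lsc_facet_measurable[OF u F])
    finally have "ennreal (c F) * (M * emeasure lborel (ball p \<eta>)) \<le> ennreal (c F) * (\<integral>\<^sup>+x\<in>F. u x \<partial>facet_lebesgue F)"
      by (rule mult_left_mono) simp
    also have "\<dots> \<le> BI u" by (rule facet_le_boundary_integral[OF F])
    finally show ?thesis
      using weight_pos[OF F] unfolding em \<kappa>_def by (simp add: ennreal_mult mult_ac)
  qed
  ultimately show thesis by (rule that)
qed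

text \<open>A closed half space supporting the sublevel set \<open>{u < u y}\<close> at \<open>y\<close> has a vertex of \<open>P\<close> at
  depth at least \<open>\<delta>\<close> on its far side.\<close>
lemma vertex_near_which_large:
  assumes u: "enn_convex_on P u" and \<delta>: "\<delta> > 0" and y: "ball y \<delta> \<subseteq> P"
  obtains v where "v extreme_point_of P" "\<And>z. z \<in> P \<Longrightarrow> dist z v < \<delta> \<Longrightarrow> u y \<le> u z"
proof -
  let ?S = "{z\<in>P. u z < u y}"
  have "convex ?S"
    unfolding convex_alt
  proof safe
    fix x z and t :: real assume *: "x \<in> P" "u x < u y" "z \<in> P" "u z < u y" "0 \<le> t" "t \<le> 1"
    then show "(1 - t) *\<^sub>R x + t *\<^sub>R z \<in> P" using convex_P by (auto simp: convex_alt)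
    have "u ((1 - t) *\<^sub>R x + t *\<^sub>R z) \<le> max (u x) (u z)"
      using * by (intro enn_convex_on_max[OF u]) auto
    then show "u ((1 - t) *\<^sub>R x + t *\<^sub>R z) < u y" using * by (auto simp: max_def split: if_splits)
  qed
  then have "convex ((+) (-y) ` ?S)" by (rule convex_translation)
  moreover have "0 \<notin> (+) (-y) ` ?S" by auto
  \<comment> \<open>The strict sublevel set is convex and omits \<open>y\<close>, so it lies on one
    side of a hyperplane through \<open>y\<close>.\<close>
  ultimately obtain a where a: "a \<noteq> 0" "\<And>x. x \<in> (+) (-y) ` ?S \<Longrightarrow> 0 \<le> a \<bullet> x"
    using separating_hyperplane_set_0 by metis
  let ?V = "{v. v extreme_point_of P}"
  have V: "finite ?V" "P = convex hull ?V"
    using finite_polyhedron_extreme_points[OF polyhedron_P] Krein_Milman_Minkowski[OF compact_P convex_P] by auto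
  have "?V \<noteq> {}" using V(2) interior_P by (metis convex_hull_empty interior_empty)
  \<comment> \<open>Since \<open>P\<close> is the hull of its vertices, the minimum of
    \<open>a\<close> over the vertices is its minimum over \<open>P\<close>.\<close>
  then obtain v where v: "v \<in> ?V" "\<And>w. w \<in> ?V \<Longrightarrow> a \<bullet> v \<le> a \<bullet> w"
    using ex_is_arg_min_if_finite[OF V(1), of "\<lambda>w. a \<bullet> w"] by (auto simp: is_arg_min_linorder)
  have "convex hull ?V \<subseteq> {z. a \<bullet> z \<ge> a \<bullet> v}"
    using v(2) by (intro hull_minimal convex_halfspace_ge) auto
  then have av: "a \<bullet> v \<le> a \<bullet> z" if "z \<in> P" for z using that V(2) by auto
  have "u y \<le> u z" if z: "z \<in> P" "dist z v < \<delta>" for z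
  proof (rule ccontr)
    assume "\<not> u y \<le> u z"
    then have "0 \<le> a \<bullet> (z - y)" using a(2)[of "z - y"] z(1) by auto
    \<comment> \<open>For \<open>t\<close> strictly between \<open>dist z v\<close> and \<delta>,
      moving from \<open>y\<close> by \<open>t\<close> against \<open>a\<close> stays in
      \<open>P\<close>. So \<open>v\<close> lies deeper than \<open>y\<close> by at least
      \<open>t\<close>, while \<open>z\<close> is closer than \<open>t\<close> to \<open>v\<close>;
      this puts \<open>z\<close> strictly on the far side.\<close>
    moreover define t where "t = (dist z v + \<delta>) / 2"
    have t: "dist z v < t" "0 \<le> t" "t < \<delta>" using z(2) \<delta> by (auto simp: t_def add_nonneg_nonneg)
    have "y - (t / norm a) *\<^sub>R a \<in> P" using t a(1) y by (auto simp: dist_norm)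
    from av[OF this] have "a \<bullet> v \<le> a \<bullet> y - t * norm a"
      using a(1) by (simp add: inner_diff_right power2_norm_eq_inner[symmetric] power2_eq_square)
    moreover have "a \<bullet> (z - v) \<le> norm a * dist z v"
      using norm_cauchy_schwarz[of a "z - v"] by (simp add: dist_norm)
    moreover have "norm a * dist z v < norm a * t" using t(1) a(1) by simp
    ultimately show False by (simp add: inner_diff_right mult.commute)
  qed
  then show thesis using v(1) that by auto
qed

text \<open>Every vertex lies on some facet, near which a function that is large around the vertex
  has a large integral. As there are finitely many vertices, the least of their constants works for
  every \<open>y\<close> with a \<delta>-ball in \<open>P\<close>.\<close>

lemma interior_bound:
  assumes \<delta>: "\<delta> > 0"
  obtains \<kappa> :: real where "\<kappa> > 0"
    "\<And>u y. lsc_on P u \<Longrightarrow> enn_convex_on P u \<Longrightarrow> ball y \<delta> \<subseteq> P \<Longrightarrow> ennreal \<kappa> * u y \<le> BI u"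
proof -
  let ?V = "{v. v extreme_point_of P}"
  have "\<exists>\<kappa>::real. \<kappa> > 0 \<and> (\<forall>u M. lsc_on P u \<longrightarrow> (\<forall>z\<in>P. dist z v < \<delta> \<longrightarrow> M \<le> u z) \<longrightarrow> ennreal \<kappa> * M \<le> BI u)"
    if v: "v \<in> ?V" for v
  proof -
    have "card {F. F facet_of P \<and> v \<in> F} = DIM('a)" using v by (intro card_facets_vertex) (simp add: face_of_singleton)
    then obtain F where F: "F facet_of P" "v \<in> F"
      using DIM_positive[where 'a='a] by (metis (no_types, lifting) Collect_empty_eq card.empty less_irrefl)
    obtain \<kappa> where "\<kappa> > 0"
      "\<And>u M. lsc_on P u \<Longrightarrow> (\<And>z. z \<in> F \<Longrightarrow> dist z v < \<delta> \<Longrightarrow> M \<le> u z) \<Longrightarrow> ennreal \<kappa> * M \<le> BI u"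
      using boundary_integral_ge_near_facet_point[OF F \<delta>] by blast
    moreover have "F \<subseteq> P" using F facet_of_imp_subset by auto
    ultimately show ?thesis by (intro exI[of _ \<kappa>]) blast
  qed
  then obtain k where k: "\<And>v. v \<in> ?V \<Longrightarrow> k v > (0::real)"
    "\<And>v u M. v \<in> ?V \<Longrightarrow> lsc_on P u \<Longrightarrow> (\<And>z. z \<in> P \<Longrightarrow> dist z v < \<delta> \<Longrightarrow> M \<le> u z) \<Longrightarrow> ennreal (k v) * M \<le> BI u"
    by metis
  have fin: "finite ?V" using finite_polyhedron_extreme_points[OF polyhedron_P] by simp
  define \<kappa> where "\<kappa> = Min (insert 1 (k ` ?V))"
  have "\<kappa> > 0" unfolding \<kappa>_def using fin k(1) by (subst Min_gr_iff) auto
  moreover have "ennreal \<kappa> * u y \<le> BI u"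
    if u: "lsc_on P u" "enn_convex_on P u" and y: "ball y \<delta> \<subseteq> P" for u y
  proof -
    obtain v where v: "v extreme_point_of P" "\<And>z. z \<in> P \<Longrightarrow> dist z v < \<delta> \<Longrightarrow> u y \<le> u z"
      using vertex_near_which_large[OF u(2) \<delta> y] by metis
    have "\<kappa> \<le> k v" unfolding \<kappa>_def using fin v(1) by (intro Min_le) auto
    then have "ennreal \<kappa> * u y \<le> ennreal (k v) * u y" by (intro mult_right_mono ennreal_leI) auto
    also have "\<dots> \<le> BI u" using v by (intro k(2) u) auto
    finally show ?thesis .
  qed
  ultimately show thesis by (rule that)
qed

text \<open>Average \<open>u\<close> over a symmetric parallelepiped in \<open>F\<close> about
  \<open>x\<close>, realised in the slab as \<open>E\<close>. Convexity at pairs of opposite points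
  bounds \<open>u x\<close> by the average, and the volume of \<open>E\<close> is at least a
  constant times the product of the levels of the other facets.\<close>

lemma facet_point_bound:
  assumes x0: "x0 \<in> P" and F: "F \<in> act x0"
  obtains \<kappa> \<rho> :: real where "\<kappa> > 0" "\<rho> > 0"
    "\<And>u x. lsc_on P u \<Longrightarrow> enn_convex_on P u \<Longrightarrow> x \<in> F \<Longrightarrow> dist x x0 < \<rho> \<Longrightarrow>
       ennreal (\<kappa> * (\<Prod>G\<in>act x0 - {F}. lev G x)) * u x \<le> BI u"
proof -
  have Ff: "F facet_of P" using F by (simp add: act_def)
  define a where "a = fst (facet_eqn F)"
  have a1: "norm a = 1" unfolding a_def by (rule facet_eqn_spec(1)[OF interior_P Ff])
  then have aa: "a \<bullet> a = 1" by (simp add: norm_eq_1)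
  obtain \<rho>0 where \<rho>0: "\<rho>0 > 0"
    "\<And>z. dist z x0 < \<rho>0 \<Longrightarrow> (\<And>F. F \<in> act x0 \<Longrightarrow> lev F z \<ge> 0) \<Longrightarrow> z \<in> P"
    using locally_cone[OF x0] by metis
  \<comment> \<open>For \<open>G\<close> other than \<open>F\<close> this is the part of the normal
    tangential to \<open>F\<close>, so it measures the change of \<open>lev G\<close> after
    projection to \<open>F\<close>. For \<open>F\<close> itself it measures height in the
    slab.\<close>
  define f where "f G = (if G = F then a else nrm G - (nrm G \<bullet> a) *\<^sub>R a)" for G
  have "\<exists>D. \<forall>H\<in>act x0. nrm H \<bullet> D = (if H = G then 1 else 0)" for G
    using independent_inner_solve[OF act_independent(1,2)[OF x0], of "\<lambda>H. if H = G then 1 else 0"] by metis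
  then obtain D where D: "\<And>G H. H \<in> act x0 \<Longrightarrow> nrm H \<bullet> D G = (if H = G then 1 else 0)" by metis
  have aD: "a \<bullet> D G = 0" if "G \<noteq> F" for G
    using D[OF F, of G] that facet_eqn_nrm[of F] by (auto simp: a_def)
  \<comment> \<open>With \<open>a\<close> replacing the dual vector of \<open>F\<close>, the dual
    basis of the normals becomes biorthogonal to the vectors \<open>f G\<close>, which makes them
    independent.\<close>
  let ?D = "\<lambda>G. if G = F then a else D G"
  have bi: "f G \<bullet> ?D G \<noteq> 0" if "G \<in> act x0" for G
    using that by (auto simp: f_def aa D aD inner_diff_left)
  have bi': "f H \<bullet> ?D G = 0" if "G \<in> act x0" "H \<in> act x0" "G \<noteq> H" for G H
    using that by (auto simp: f_def aa D aD inner_diff_left)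
  have indep: "inj_on f (act x0)" "independent (f ` act x0)"
    using independent_if_biorthogonal[of "act x0" f ?D] bi bi' by blast+
  obtain k where k: "k > 0"
    "\<And>p h. (\<And>G. G \<in> act x0 \<Longrightarrow> 0 \<le> h G \<and> h G \<le> 1) \<Longrightarrow>
       ennreal (k * (\<Prod>G\<in>act x0. h G)) \<le>
       emeasure lborel {z. dist z p < \<rho>0 / 2 \<and> (\<forall>G\<in>act x0. \<bar>f G \<bullet> (z - p)\<bar> \<le> h G)}"
    using emeasure_parallelepiped_ge[OF indep, of "\<rho>0 / 2"] \<rho>0(1) half_gt_zero by blast
  \<comment> \<open>Half of \<open>\<rho>0\<close> is left for the extent of \<open>E\<close>; the
    bound 1 keeps the levels at \<open>x\<close>, used as widths, at most 1.\<close>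
  define \<rho> where "\<rho> = min 1 (\<rho>0 / 2)"
  define \<kappa> where "\<kappa> = c F * k / 2"
  have main: "ennreal (\<kappa> * (\<Prod>G\<in>act x0 - {F}. lev G x)) * u x \<le> BI u"
    if u: "lsc_on P u" "enn_convex_on P u" and x: "x \<in> F" "dist x x0 < \<rho>" for u x
  proof -
    have xP: "x \<in> P" using x(1) Ff facet_of_imp_subset by auto
    define p where "p = x + (1/2) *\<^sub>R a"
    note prj = prj_centre[OF Ff x(1), folded a_def, folded p_def]
    \<comment> \<open>A tangential width of \<open>lev G x\<close> is the largest that keeps
      \<open>lev G\<close> nonnegative on the projection. The width 1/2 across \<open>F\<close> fits
      the slab of thickness 1 centred at height 1/2, and accounts for the division by 2 in
      \<kappa>.\<close>
    define h where "h G = (if G = F then 1/2 else lev G x)" for G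
    have h: "0 \<le> h G \<and> h G \<le> 1" if G: "G \<in> act x0" for G
    proof -
      have "G facet_of P" "lev G x0 = 0" using G facet_eq[of G] by (auto simp: act_def)
      then show ?thesis
        using lev_nonneg[of G x] lev_lipschitz[of G x x0] xP x(2) by (auto simp: h_def \<rho>_def)
    qed
    define E where "E = {z. dist z p < \<rho>0 / 2 \<and> (\<forall>G\<in>act x0. \<bar>f G \<bullet> (z - p)\<bar> \<le> h G)}"
    have E: "z \<in> slab F" "prj F z \<in> F" if z: "z \<in> E" for z
    proof -
      have fz: "\<bar>f G \<bullet> (z - p)\<bar> \<le> h G" if "G \<in> act x0" for G using z that by (auto simp: E_def)
      from fz[OF F] show "z \<in> slab F" by (intro prj(4)) (simp add: f_def h_def)
      have "prj F z \<in> P"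
      proof (rule \<rho>0(2))
        show "dist (prj F z) x0 < \<rho>0"
          using dist_triangle[of "prj F z" x0 x] prj(2)[of z] z x(2) by (simp add: E_def \<rho>_def dist_norm)
        fix G assume G: "G \<in> act x0"
        show "lev G (prj F z) \<ge> 0"
        proof (cases "G = F")
          case False
          have "lev G (prj F z) = lev G x + nrm G \<bullet> (prj F z - x)" by (rule lev_diff)
          also have "nrm G \<bullet> (prj F z - x) = f G \<bullet> (z - p)"
            unfolding prj(1) using False
            by (simp add: f_def inner_diff_left inner_diff_right algebra_simps)
          finally show ?thesis using fz[OF G] False by (simp add: h_def abs_le_iff)
        qed (simp add: prj(3))
      qed
      then show "prj F z \<in> F" using prj(3) facet_eq[OF Ff] by auto
    qed
    have E': "p + p - z \<in> E" if "z \<in> E" for z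
    proof -
      have "p + p - z - p = - (z - p)" by simp
      then show ?thesis using that unfolding E_def mem_Collect_eq dist_norm by (metis abs_minus_cancel inner_minus_right norm_minus_cancel)
    qed
    \<comment> \<open>Reflection of the slab in \<open>p\<close> projects to reflection of the facet
      in \<open>x\<close>, and it preserves Lebesgue measure, so the two halves of the average below
      have equal integrals.\<close>
    have mid: "x = (1 - 1/2) *\<^sub>R prj F z + (1/2) *\<^sub>R prj F (p + p - z)" for z
    proof -
      have e: "p + p - z - p = - (z - p)" by simp
      have "prj F (p + p - z) - x = - (prj F z - x)"
        unfolding prj(1) e inner_minus_right by simp
      then have "prj F (p + p - z) = x + x - prj F z" by (simp add: algebra_simps)
      then have "(1/2) *\<^sub>R (prj F z + prj F (p + p - z)) = x" by simp
      then show ?thesis by (simp add: scaleR_add_right)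
    qed
    define g where "g z = indicator (slab F) z * (u (prj F z) * indicator F (prj F z))" for z
    have um: "(\<lambda>x. u x * indicator F x) \<in> borel_measurable borel" by (rule lsc_facet_measurable[OF u(1) Ff])
    have gm[measurable]: "g \<in> borel_measurable borel"
      unfolding g_def using measurable_compose[OF measurable_prj um] by measurable
    have Emeas[measurable]: "E \<in> sets borel"
    proof -
      have "E = {z \<in> space borel. dist z p < \<rho>0 / 2 \<and> (\<forall>G\<in>act x0. \<bar>f G \<bullet> (z - p)\<bar> \<le> h G)}"
        by (simp add: E_def)
      also have "\<dots> \<in> sets borel" using finite_act[of x0] by measurable
      finally show ?thesis .
    qed
    have "u x * emeasure lborel E = (\<integral>\<^sup>+z. u x * indicator E z \<partial>lborel)"
      by (rule nn_integral_cmult_indicator[symmetric]) simp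
    also have "\<dots> \<le> (\<integral>\<^sup>+z. ennreal (1/2) * g z + ennreal (1/2) * g (p + p - z) \<partial>lborel)"
    proof (rule nn_integral_mono)
      fix z
      show "u x * indicator E z \<le> ennreal (1/2) * g z + ennreal (1/2) * g (p + p - z)"
      proof (cases "z \<in> E")
        case True
        have "u ((1 - 1/2) *\<^sub>R prj F z + (1/2) *\<^sub>R prj F (p + p - z))
            \<le> ennreal (1 - 1/2) * u (prj F z) + ennreal (1/2) * u (prj F (p + p - z))"
          using E(2)[OF True] E(2)[OF E'[OF True]] facet_of_imp_subset[OF Ff]
          by (intro enn_convex_onD[OF u(2)]) auto
        then show ?thesis using True E[OF True] E[OF E'[OF True]] mid[of z] by (simp add: g_def)
      qed simp
    qed
    also have "\<dots> = ennreal (1/2) * (\<integral>\<^sup>+z. g z \<partial>lborel) + ennreal (1/2) * (\<integral>\<^sup>+z. g (p + p - z) \<partial>lborel)"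
      by (subst nn_integral_add) (auto simp: nn_integral_cmult)
    also have "(\<integral>\<^sup>+z. g (p + p - z) \<partial>lborel) = (\<integral>\<^sup>+z. g z \<partial>lborel)"
      by (rule nn_integral_lborel_reflect[OF gm])
    also have "ennreal (1/2) * (\<integral>\<^sup>+z. g z \<partial>lborel) + ennreal (1/2) * (\<integral>\<^sup>+z. g z \<partial>lborel) = (\<integral>\<^sup>+z. g z \<partial>lborel)"
      unfolding distrib_right[symmetric] by (subst ennreal_plus[symmetric]) simp_all
    also have "\<dots> = (\<integral>\<^sup>+x\<in>F. u x \<partial>facet_lebesgue F)"
      unfolding g_def by (rule nn_integral_facet[OF um, symmetric])
    finally have *: "u x * emeasure lborel E \<le> (\<integral>\<^sup>+x\<in>F. u x \<partial>facet_lebesgue F)" .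
    have hp: "(\<Prod>G\<in>act x0. h G) = (1/2) * (\<Prod>G\<in>act x0 - {F}. lev G x)"
      using F finite_act[of x0] by (subst prod.remove[of _ F]) (auto simp: h_def intro!: prod.cong)
    have "\<kappa> * (\<Prod>G\<in>act x0 - {F}. lev G x) = c F * (k * (\<Prod>G\<in>act x0. h G))"
      by (simp add: \<kappa>_def hp)
    then have "ennreal (\<kappa> * (\<Prod>G\<in>act x0 - {F}. lev G x)) = ennreal (c F) * ennreal (k * (\<Prod>G\<in>act x0. h G))"
      using weight_pos[OF Ff] by (simp only: ennreal_mult' less_imp_le)
    then have "ennreal (\<kappa> * (\<Prod>G\<in>act x0 - {F}. lev G x)) * u x = ennreal (c F) * (u x * ennreal (k * (\<Prod>G\<in>act x0. h G)))"
      by (simp only: mult_ac)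
    also have "\<dots> \<le> ennreal (c F) * (u x * emeasure lborel E)"
      unfolding E_def by (intro mult_left_mono k(2) h) auto
    also have "\<dots> \<le> ennreal (c F) * (\<integral>\<^sup>+x\<in>F. u x \<partial>facet_lebesgue F)"
      by (intro mult_left_mono *) simp
    also have "\<dots> \<le> BI u" by (rule facet_le_boundary_integral[OF Ff])
    finally show ?thesis .
  qed
  show thesis
    by (rule that[of \<kappa> \<rho>]) (use weight_pos[OF Ff] k(1) \<rho>0(1) main in \<open>auto simp: \<kappa>_def \<rho>_def\<close>)
qed

end

section \<open>Bounds near an arbitrary point, in terms of the levels\<close>

context weighted_simple_polytope
begin

text \<open>The line through \<open>x\<close> in direction \<open>d\<close> meets \<open>F\<close>
  at \<open>y\<close> and, on the other side of \<open>x\<close>, a point \<open>w\<close> of fixed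
  depth in \<open>P\<close>; then \<open>u x\<close> is at most the larger of \<open>u y\<close> and
  \<open>u w\<close>, to which the two previous bounds apply.\<close>

lemma near_facet_bound:
  assumes x0: "x0 \<in> P" and F: "F \<in> act x0"
  obtains \<kappa> \<rho> :: real where "\<kappa> > 0" "\<rho> > 0"
    "\<And>u x. lsc_on P u \<Longrightarrow> enn_convex_on P u \<Longrightarrow> x \<in> P \<Longrightarrow> dist x x0 < \<rho> \<Longrightarrow>
       (\<And>G. G \<in> act x0 \<Longrightarrow> lev F x \<le> lev G x) \<Longrightarrow>
       ennreal (\<kappa> * (\<Prod>G\<in>act x0 - {F}. lev G x)) * u x \<le> BI u"
proof -
  have Ff: "F facet_of P" using F by (simp add: act_def)
  \<comment> \<open>At rates 1 and 1/2, moving back from \<open>x\<close> to \<open>F\<close> lowers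
    every other level by half of \<open>lev F x\<close>. Since \<open>F\<close> is nearest, each
    other level keeps at least half its value.\<close>
  obtain d where d: "\<And>G. G \<in> act x0 \<Longrightarrow> nrm G \<bullet> d = (if G = F then 1 else 1/2)"
    using independent_inner_solve[OF act_independent(1,2)[OF x0], of "\<lambda>G. if G = F then 1 else 1/2"] by metis
  obtain \<rho>0 where \<rho>0: "\<rho>0 > 0"
    "\<And>z. dist z x0 < \<rho>0 \<Longrightarrow> (\<And>F. F \<in> act x0 \<Longrightarrow> lev F z \<ge> 0) \<Longrightarrow> z \<in> P"
    using locally_cone[OF x0] by metis
  obtain \<kappa>1 \<rho>1 where b1: "\<kappa>1 > 0" "\<rho>1 > 0"
    "\<And>u x. lsc_on P u \<Longrightarrow> enn_convex_on P u \<Longrightarrow> x \<in> F \<Longrightarrow> dist x x0 < \<rho>1 \<Longrightarrow>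
       ennreal (\<kappa>1 * (\<Prod>G\<in>act x0 - {F}. lev G x)) * u x \<le> BI u"
    using facet_point_bound[OF x0 F] by blast
  define N where "N = 1 + norm d"
  have N: "N \<ge> 1" by (simp add: N_def)
  \<comment> \<open>The step from \<open>x\<close> to \<open>w\<close> raises all active levels by
    at least \<open>s / 2\<close>, so the ball of radius \<open>s / 2\<close> about \<open>w\<close>
    satisfies the active constraints. The size of \<open>s\<close> keeps that ball within
    \<open>\<rho>0\<close> of \<open>x0\<close>.\<close>
  define s where "s = \<rho>0 / (4 * N)"
  have s: "s > 0" "s * norm d \<le> \<rho>0 / 4" "s \<le> \<rho>0 / 4"
  proof -
    show "s > 0" using \<rho>0(1) N by (simp add: s_def)
    have "s * N = \<rho>0 / 4" using N by (simp add: s_def)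
    moreover have "s * norm d \<le> s * N" "s * 1 \<le> s * N"
      using \<open>s > 0\<close> N by (auto simp: N_def intro!: mult_left_mono)
    ultimately show "s * norm d \<le> \<rho>0 / 4" "s \<le> \<rho>0 / 4" by auto
  qed
  obtain \<kappa>2 where b2: "\<kappa>2 > 0"
    "\<And>u y. lsc_on P u \<Longrightarrow> enn_convex_on P u \<Longrightarrow> ball y (s/2) \<subseteq> P \<Longrightarrow> ennreal \<kappa>2 * u y \<le> BI u"
    using interior_bound[of "s/2"] s(1) half_gt_zero by blast
  \<comment> \<open>The point \<open>y\<close> is at distance at most \<open>N * dist x x0\<close>
    from \<open>x0\<close>, whence the division by \<open>N\<close>.\<close>
  define \<rho> where "\<rho> = min 1 (min (\<rho>0 / 4) \<rho>1 / N)"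
  have \<rho>: "\<rho> > 0" "\<rho> \<le> 1" "\<rho> * N \<le> \<rho>0 / 4" "\<rho> * N \<le> \<rho>1"
  proof -
    show "\<rho> > 0" "\<rho> \<le> 1" using \<rho>0(1) b1(2) N by (auto simp: \<rho>_def)
    have "\<rho> \<le> min (\<rho>0 / 4) \<rho>1 / N" by (simp add: \<rho>_def)
    then have "\<rho> * N \<le> min (\<rho>0 / 4) \<rho>1" using N by (simp add: pos_le_divide_eq)
    then show "\<rho> * N \<le> \<rho>0 / 4" "\<rho> * N \<le> \<rho>1" by auto
  qed
  have "\<rho> * 1 \<le> \<rho> * N" using \<rho>(1) N by (intro mult_left_mono) auto
  then have \<rho>4: "\<rho> \<le> \<rho>0 / 4" using \<rho>(3) by simp
  define k where "k = card (act x0 - {F})"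
  \<comment> \<open>The power of 2 pays for halving each of the \<open>k\<close> other levels
    between \<open>x\<close> and \<open>y\<close>.\<close>
  define \<kappa> where "\<kappa> = min (\<kappa>1 / 2 ^ k) \<kappa>2"
  have \<kappa>: "\<kappa> > 0" "\<kappa> \<le> \<kappa>1 / 2 ^ k" "\<kappa> \<le> \<kappa>2" using b1 b2 by (auto simp: \<kappa>_def)
  have main: "ennreal (\<kappa> * (\<Prod>G\<in>act x0 - {F}. lev G x)) * u x \<le> BI u"
    if u: "lsc_on P u" "enn_convex_on P u" and x: "x \<in> P" "dist x x0 < \<rho>"
      and min: "\<And>G. G \<in> act x0 \<Longrightarrow> lev F x \<le> lev G x" for u x
  proof -
    define l where "l = lev F x"
    have lev01: "0 \<le> lev G x" "lev G x \<le> dist x x0" "lev G x \<le> 1" if G: "G \<in> act x0" for G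
    proof -
      have "G facet_of P" "lev G x0 = 0" using G facet_eq[of G] by (auto simp: act_def)
      then show "0 \<le> lev G x" "lev G x \<le> dist x x0" "lev G x \<le> 1"
        using lev_nonneg[of G x] lev_lipschitz[of G x x0] x \<rho>(2) by auto
    qed
    have l: "0 \<le> l" "l \<le> dist x x0" using lev01[OF F] by (auto simp: l_def)
    define y where "y = x - l *\<^sub>R d"
    define w where "w = x + s *\<^sub>R d"
    have levy: "lev G y = lev G x - l * (if G = F then 1 else 1/2)" if "G \<in> act x0" for G
      using lev_diff[of G y x] d[OF that] by (simp add: y_def)
    have "dist y x0 \<le> dist x x0 + l * norm d"
      using norm_triangle_ineq4[of "x - x0" "l *\<^sub>R d"] l(1) by (simp add: y_def dist_norm algebra_simps)
    also have "\<dots> \<le> dist x x0 * N" using mult_right_mono[OF l(2), of "norm d"] by (simp add: N_def algebra_simps)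
    also have "\<dots> < \<rho> * N" using x(2) N by simp
    finally have dy: "dist y x0 < \<rho> * N" .
    have lev_y: "lev G y \<ge> lev G x / 2" if "G \<in> act x0" "G \<noteq> F" for G
      using levy[OF that(1)] min[OF that(1)] that(2) by (simp add: l_def)
    have "y \<in> P"
    proof (rule \<rho>0(2))
      show "dist y x0 < \<rho>0" using dy \<rho>(3) \<rho>0(1) by simp
      fix G assume G: "G \<in> act x0"
      show "lev G y \<ge> 0"
        using levy[OF G] lev_y[OF G] lev01(1)[OF G] by (cases "G = F") (auto simp: l_def)
    qed
    then have yF: "y \<in> F" using levy[OF F] facet_eq[OF Ff] by (auto simp: l_def)
    have ballw: "ball w (s/2) \<subseteq> P"
    proof
      fix z assume "z \<in> ball w (s/2)"
      then have z: "dist z w < s/2" by (simp add: dist_commute)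
      show "z \<in> P"
      proof (rule \<rho>0(2))
        have "dist w x = s * norm d" using s(1) by (simp add: w_def dist_norm)
        then show "dist z x0 < \<rho>0"
          using z s x(2) \<rho>4 dist_triangle[of z x0 w] dist_triangle[of w x0 x] by linarith
        fix G assume G: "G \<in> act x0"
        have "lev G w \<ge> s / 2"
          using lev_diff[of G w x] d[OF G] lev01(1)[OF G] s(1) by (auto simp: w_def)
        then show "lev G z \<ge> 0"
          using lev_lipschitz[of G z w] G z by (auto simp: act_def)
      qed
    qed
    have wP: "w \<in> P" using ballw s(1) by auto
    have ux: "u x \<le> max (u y) (u w)"
    proof -
      \<comment> \<open>This weight makes the displacements \<open>- l *\<^sub>R d\<close> of
        \<open>y\<close> and \<open>s *\<^sub>R d\<close> of \<open>w\<close> cancel.\<close>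
      define t where "t = l / (l + s)"
      have ls: "l + s > 0" using l(1) s(1) by simp
      then have t: "0 \<le> t" "t \<le> 1" using l(1) s(1) by (auto simp: t_def)
      have t0: "(1 - t) * l = t * s" using ls by (simp add: t_def field_simps)
      have "(1 - t) *\<^sub>R y + t *\<^sub>R w = x + (t * s - (1 - t) * l) *\<^sub>R d"
        by (simp add: y_def w_def algebra_simps)
      then have "(1 - t) *\<^sub>R y + t *\<^sub>R w = x" using t0 by simp
      then show ?thesis using enn_convex_on_max[OF u(2) \<open>y \<in> P\<close> wP t] by simp
    qed
    have pr0: "0 \<le> (\<Prod>G\<in>act x0 - {F}. lev G x)" by (intro prod_nonneg) (auto intro: lev01)
    have pr1: "(\<Prod>G\<in>act x0 - {F}. lev G x) \<le> 1" by (intro prod_le_1) (auto intro: lev01)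
    show ?thesis
    proof (cases "u y \<le> u w")
      \<comment> \<open>All levels are at most 1 near \<open>x0\<close>, so the product may be
        dropped and the interior bound at \<open>w\<close> suffices.\<close>
      case True
      have "\<kappa> * (\<Prod>G\<in>act x0 - {F}. lev G x) \<le> \<kappa>2 * 1"
        using \<kappa>(1,3) b2(1) pr0 pr1 by (intro mult_mono) auto
      then have "ennreal (\<kappa> * (\<Prod>G\<in>act x0 - {F}. lev G x)) * u x \<le> ennreal \<kappa>2 * u w"
        using ux True by (intro mult_mono ennreal_leI) auto
      also have "\<dots> \<le> BI u" by (rule b2(2)[OF u ballw])
      finally show ?thesis .
    next
      case False
      have "(\<Prod>G\<in>act x0 - {F}. lev G x / 2) \<le> (\<Prod>G\<in>act x0 - {F}. lev G y)"
        using lev_y lev01(1) by (intro prod_mono) auto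
      then have "(\<Prod>G\<in>act x0 - {F}. lev G x) / 2 ^ k \<le> (\<Prod>G\<in>act x0 - {F}. lev G y)"
        by (simp add: prod_dividef k_def)
      then have "\<kappa>1 * ((\<Prod>G\<in>act x0 - {F}. lev G x) / 2 ^ k) \<le> \<kappa>1 * (\<Prod>G\<in>act x0 - {F}. lev G y)"
        using b1(1) by (intro mult_left_mono) auto
      moreover have "\<kappa> * (\<Prod>G\<in>act x0 - {F}. lev G x) \<le> \<kappa>1 / 2 ^ k * (\<Prod>G\<in>act x0 - {F}. lev G x)"
        by (rule mult_right_mono[OF \<kappa>(2) pr0])
      ultimately have "\<kappa> * (\<Prod>G\<in>act x0 - {F}. lev G x) \<le> \<kappa>1 * (\<Prod>G\<in>act x0 - {F}. lev G y)" by simp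
      then have "ennreal (\<kappa> * (\<Prod>G\<in>act x0 - {F}. lev G x)) * u x \<le> ennreal (\<kappa>1 * (\<Prod>G\<in>act x0 - {F}. lev G y)) * u y"
        using ux False by (intro mult_mono[OF ennreal_leI]) (auto simp: max_def split: if_splits)
      also have "\<dots> \<le> BI u" using dy \<rho>(4) by (intro b1(3)[OF u yF]) auto
      finally show ?thesis .
    qed
  qed
  show thesis by (rule that[OF \<kappa>(1) \<rho>(1) main])
qed

text \<open>Which facet is nearest depends on \<open>x\<close>, so the least constants over the
  finitely many facets through \<open>x0\<close> are taken. Without such facets, \<open>x\<close>
  has a ball of fixed radius in \<open>P\<close>, and \<open>A = {}\<close> turns the interior bound
  into the same form.\<close>

lemma near_bound:
  assumes x0: "x0 \<in> P"
  obtains \<kappa> \<rho> :: real where "\<kappa> > 0" "\<rho> > 0"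
    "\<And>u x. lsc_on P u \<Longrightarrow> enn_convex_on P u \<Longrightarrow> x \<in> P \<Longrightarrow> dist x x0 < \<rho> \<Longrightarrow>
       \<exists>A. (act x0 = {} \<and> A = {} \<or> (\<exists>F\<in>act x0. A = act x0 - {F} \<and> (\<forall>G\<in>A. lev F x \<le> lev G x))) \<and>
         ennreal (\<kappa> * (\<Prod>G\<in>A. lev G x)) * u x \<le> BI u"
proof (cases "act x0 = {}")
  case True
  obtain \<rho>0 where \<rho>0: "\<rho>0 > 0" "\<And>z. dist z x0 < \<rho>0 \<Longrightarrow> z \<in> P"
    using locally_cone[OF x0] True by (metis empty_iff)
  obtain \<kappa> where k: "\<kappa> > 0"
    "\<And>u y. lsc_on P u \<Longrightarrow> enn_convex_on P u \<Longrightarrow> ball y (\<rho>0/2) \<subseteq> P \<Longrightarrow> ennreal \<kappa> * u y \<le> BI u"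
    using interior_bound[of "\<rho>0/2"] \<rho>0(1) half_gt_zero by blast
  have "ball x (\<rho>0/2) \<subseteq> P" if "dist x x0 < \<rho>0/2" for x
  proof
    fix z assume "z \<in> ball x (\<rho>0/2)"
    then show "z \<in> P" using that dist_triangle[of z x0 x] by (intro \<rho>0(2)) (simp add: dist_commute)
  qed
  then show thesis using True k \<rho>0(1) by (intro that[of \<kappa> "\<rho>0/2"]) auto
next
  case False
  have "\<forall>F\<in>act x0. \<exists>p::real\<times>real. fst p > 0 \<and> snd p > 0 \<and>
    (\<forall>u x. lsc_on P u \<longrightarrow> enn_convex_on P u \<longrightarrow> x \<in> P \<longrightarrow> dist x x0 < snd p \<longrightarrow>
       (\<forall>G\<in>act x0. lev F x \<le> lev G x) \<longrightarrow>
       ennreal (fst p * (\<Prod>G\<in>act x0 - {F}. lev G x)) * u x \<le> BI u)"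
  proof
    fix F assume F: "F \<in> act x0"
    obtain \<kappa> \<rho> :: real where "\<kappa> > 0" "\<rho> > 0"
      "\<And>u x. lsc_on P u \<Longrightarrow> enn_convex_on P u \<Longrightarrow> x \<in> P \<Longrightarrow> dist x x0 < \<rho> \<Longrightarrow>
       (\<And>G. G \<in> act x0 \<Longrightarrow> lev F x \<le> lev G x) \<Longrightarrow>
       ennreal (\<kappa> * (\<Prod>G\<in>act x0 - {F}. lev G x)) * u x \<le> BI u"
      using near_facet_bound[OF x0 F] by blast
    then show "\<exists>p::real\<times>real. fst p > 0 \<and> snd p > 0 \<and>
      (\<forall>u x. lsc_on P u \<longrightarrow> enn_convex_on P u \<longrightarrow> x \<in> P \<longrightarrow> dist x x0 < snd p \<longrightarrow>
       (\<forall>G\<in>act x0. lev F x \<le> lev G x) \<longrightarrow>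
       ennreal (fst p * (\<Prod>G\<in>act x0 - {F}. lev G x)) * u x \<le> BI u)"
      by (intro exI[of _ "(\<kappa>, \<rho>)"]) auto
  qed
  from bchoice[OF this] obtain p :: "'a set \<Rightarrow> real \<times> real" where p0:
    "\<forall>F\<in>act x0. fst (p F) > 0 \<and> snd (p F) > 0 \<and>
    (\<forall>u x. lsc_on P u \<longrightarrow> enn_convex_on P u \<longrightarrow> x \<in> P \<longrightarrow> dist x x0 < snd (p F) \<longrightarrow>
       (\<forall>G\<in>act x0. lev F x \<le> lev G x) \<longrightarrow>
       ennreal (fst (p F) * (\<Prod>G\<in>act x0 - {F}. lev G x)) * u x \<le> BI u)" ..
  then have p: "\<And>F. F \<in> act x0 \<Longrightarrow> fst (p F) > 0" "\<And>F. F \<in> act x0 \<Longrightarrow> snd (p F) > (0::real)"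
    "\<And>F u x. F \<in> act x0 \<Longrightarrow> lsc_on P u \<Longrightarrow> enn_convex_on P u \<Longrightarrow> x \<in> P \<Longrightarrow> dist x x0 < snd (p F) \<Longrightarrow>
       (\<forall>G\<in>act x0. lev F x \<le> lev G x) \<Longrightarrow>
       ennreal (fst (p F) * (\<Prod>G\<in>act x0 - {F}. lev G x)) * u x \<le> BI u"
    by blast+
  define \<kappa> where "\<kappa> = Min ((fst \<circ> p) ` act x0)"
  define \<rho> where "\<rho> = Min ((snd \<circ> p) ` act x0)"
  have pos: "\<kappa> > 0" "\<rho> > 0" unfolding \<kappa>_def \<rho>_def using False p(1,2) finite_act by (auto simp: Min_gr_iff)
  have main: "\<exists>A. (act x0 = {} \<and> A = {} \<or> (\<exists>F\<in>act x0. A = act x0 - {F} \<and> (\<forall>G\<in>A. lev F x \<le> lev G x))) \<and>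
         ennreal (\<kappa> * (\<Prod>G\<in>A. lev G x)) * u x \<le> BI u"
    if u: "lsc_on P u" "enn_convex_on P u" and x: "x \<in> P" "dist x x0 < \<rho>" for u x
  proof -
    obtain F where F: "F \<in> act x0" "\<And>G. G \<in> act x0 \<Longrightarrow> lev F x \<le> lev G x"
      using ex_is_arg_min_if_finite[OF finite_act False, of "\<lambda>G. lev G x"] by (auto simp: is_arg_min_linorder)
    have le: "\<kappa> \<le> fst (p F)" "\<rho> \<le> snd (p F)"
      unfolding \<kappa>_def \<rho>_def using F(1) finite_act by (auto intro!: Min_le)
    have "0 \<le> (\<Prod>G\<in>act x0 - {F}. lev G x)"
      using x(1) by (intro prod_nonneg) (auto simp: act_def lev_nonneg)
    then have "ennreal (\<kappa> * (\<Prod>G\<in>act x0 - {F}. lev G x)) * u x \<le> ennreal (fst (p F) * (\<Prod>G\<in>act x0 - {F}. lev G x)) * u x"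
      using le(1) by (intro mult_right_mono ennreal_leI) auto
    also have "\<dots> \<le> BI u" using F x le(2) by (intro p(3) u) auto
    finally show ?thesis using F by (intro exI[of _ "act x0 - {F}"]) auto
  qed
  show thesis by (rule that[OF pos main])
qed

text \<open>Omitting the nearest of at most one facet leaves an empty product, hence a bound uniform
  in \<open>x\<close>.\<close>

lemma near_bound_few_facets:
  assumes x0: "x0 \<in> P" "card (act x0) \<le> 1"
  obtains \<kappa> \<rho> :: real where "\<kappa> > 0" "\<rho> > 0"
    "\<And>u x. lsc_on P u \<Longrightarrow> enn_convex_on P u \<Longrightarrow> x \<in> P \<Longrightarrow> dist x x0 < \<rho> \<Longrightarrow> ennreal \<kappa> * u x \<le> BI u"
proof -
  obtain \<kappa> \<rho> :: real where *: "\<kappa> > 0" "\<rho> > 0"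
    "\<And>u x. lsc_on P u \<Longrightarrow> enn_convex_on P u \<Longrightarrow> x \<in> P \<Longrightarrow> dist x x0 < \<rho> \<Longrightarrow>
       \<exists>A. (act x0 = {} \<and> A = {} \<or> (\<exists>F\<in>act x0. A = act x0 - {F} \<and> (\<forall>G\<in>A. lev F x \<le> lev G x))) \<and>
         ennreal (\<kappa> * (\<Prod>G\<in>A. lev G x)) * u x \<le> BI u"
    using near_bound[OF x0(1)] by blast
  have "ennreal \<kappa> * u x \<le> BI u"
    if u: "lsc_on P u" "enn_convex_on P u" and x: "x \<in> P" "dist x x0 < \<rho>" for u x
  proof -
    obtain A where A: "act x0 = {} \<and> A = {} \<or> (\<exists>F\<in>act x0. A = act x0 - {F})"
      "ennreal (\<kappa> * (\<Prod>G\<in>A. lev G x)) * u x \<le> BI u"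
      using *(3)[OF u x] by blast
    have "act x0 - {F} = {}" if "F \<in> act x0" for F
    proof -
      have "card (act x0 - {F}) = 0" using that x0(2) finite_act[of x0] by (simp add: card_Diff_singleton)
      then show ?thesis using finite_act[of x0] by simp
    qed
    then have "A = {}" using A(1) by auto
    then show ?thesis using A(2) by simp
  qed
  with *(1,2) show thesis by (rule that)
qed

text \<open>Geometric mean of the bounds that omit one facet: the smallest level is at most
  the \<open>(m - 1)\<close>-st root of the product of the others.\<close>
lemma near_bound_powr:
  assumes x0: "x0 \<in> P"
  defines "\<beta> \<equiv> (real (card (act x0)) - 1) / real (card (act x0))"
  obtains \<kappa> \<rho> :: real where "\<kappa> > 0" "\<rho> > 0"
    "\<And>u x. lsc_on P u \<Longrightarrow> enn_convex_on P u \<Longrightarrow> x \<in> P \<Longrightarrow> dist x x0 < \<rho> \<Longrightarrow>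
       (\<And>G. G \<in> act x0 \<Longrightarrow> lev G x > 0) \<Longrightarrow>
       ennreal (\<kappa> * (\<Prod>G\<in>act x0. lev G x powr \<beta>)) * u x \<le> BI u"
proof -
  obtain \<kappa> \<rho> :: real where *: "\<kappa> > 0" "\<rho> > 0"
    "\<And>u x. lsc_on P u \<Longrightarrow> enn_convex_on P u \<Longrightarrow> x \<in> P \<Longrightarrow> dist x x0 < \<rho> \<Longrightarrow>
       \<exists>A. (act x0 = {} \<and> A = {} \<or> (\<exists>F\<in>act x0. A = act x0 - {F} \<and> (\<forall>G\<in>A. lev F x \<le> lev G x))) \<and>
         ennreal (\<kappa> * (\<Prod>G\<in>A. lev G x)) * u x \<le> BI u"
    using near_bound[OF x0(1)] by blast
  have "ennreal (\<kappa> * (\<Prod>G\<in>act x0. lev G x powr \<beta>)) * u x \<le> BI u"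
    if u: "lsc_on P u" "enn_convex_on P u" and x: "x \<in> P" "dist x x0 < \<rho>"
      and pos: "\<And>G. G \<in> act x0 \<Longrightarrow> lev G x > 0" for u x
  proof -
    obtain A where A: "act x0 = {} \<and> A = {} \<or> (\<exists>F\<in>act x0. A = act x0 - {F} \<and> (\<forall>G\<in>A. lev F x \<le> lev G x))"
      "ennreal (\<kappa> * (\<Prod>G\<in>A. lev G x)) * u x \<le> BI u"
      using *(3)[OF u x] by blast
    have "(\<Prod>G\<in>act x0. lev G x powr \<beta>) \<le> (\<Prod>G\<in>A. lev G x)"
      using A(1)
    \<comment> \<open>If no facet passes through \<open>x0\<close>, both products are empty.
      Otherwise \<open>q\<close> consists of \<open>m - 1\<close> factors, each at least
      \<open>lev F x\<close>, and the exponents \<open>1/m\<close> and \<beta> of \<open>q\<close>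
      add up to 1.\<close>
    proof (elim disjE bexE conjE)
      fix F assume F: "F \<in> act x0" "A = act x0 - {F}" "\<forall>G\<in>A. lev F x \<le> lev G x"
      define m where "m = real (card (act x0))"
      define q where "q = (\<Prod>G\<in>A. lev G x)"
      have "card (act x0) \<ge> 1" using F(1) finite_act[of x0] by (simp add: Suc_le_eq card_gt_0_iff) blast
      then have m: "m \<ge> 1" "card A = card (act x0) - 1" "real (card A) = m - 1"
        using F(1,2) finite_act[of x0] by (auto simp: m_def card_Diff_singleton)
      have q: "q > 0" unfolding q_def using pos F(2) by (intro prod_pos) auto
      have l: "lev F x > 0" by (rule pos[OF F(1)])
      have "(\<Prod>G\<in>A. lev F x) \<le> q" unfolding q_def using F(3) l by (intro prod_mono) auto
      then have "lev F x powr (m - 1) \<le> q" using l m(3) by (simp flip: powr_realpow)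
      then have "(lev F x powr (m - 1)) powr (1/m) \<le> q powr (1/m)" using m by (intro powr_mono2) auto
      then have 1: "lev F x powr \<beta> \<le> q powr (1/m)" by (simp add: powr_powr \<beta>_def m_def)
      have "(\<Prod>G\<in>act x0. lev G x powr \<beta>) = lev F x powr \<beta> * (\<Prod>G\<in>A. lev G x powr \<beta>)"
        using F(1,2) finite_act[of x0] by (simp add: prod.remove)
      also have "(\<Prod>G\<in>A. lev G x powr \<beta>) = q powr \<beta>"
        unfolding q_def using pos F(2) by (subst prod_powr_distrib) (auto intro: less_imp_le)
      also have "lev F x powr \<beta> * q powr \<beta> \<le> q powr (1/m) * q powr \<beta>" using 1 by (intro mult_right_mono) auto
      also have "\<dots> = q powr (1/m + \<beta>)" by (simp add: powr_add)
      also have "1/m + \<beta> = 1" using m(1) by (simp add: \<beta>_def m_def[symmetric] field_simps)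
      finally show ?thesis using q by (simp add: q_def)
    qed simp
    then have "ennreal (\<kappa> * (\<Prod>G\<in>act x0. lev G x powr \<beta>)) * u x \<le> ennreal (\<kappa> * (\<Prod>G\<in>A. lev G x)) * u x"
      using *(1) by (intro mult_right_mono ennreal_leI mult_left_mono) auto
    with A(2) show ?thesis by (rule order_trans[rotated])
  qed
  with *(1,2) show thesis by (rule that)
qed

end

section \<open>The extremal function\<close>

lemma measurable_enn_pow[measurable]: "(\<lambda>v. enn_pow v r) \<in> borel_measurable borel"
  unfolding enn_pow_def by measurable

lemma enn_pow_le:
  assumes "v \<le> ennreal B" "0 \<le> B" "0 \<le> r"
  shows "enn_pow v r \<le> ennreal (B powr r)"
proof (cases v)
  case (real w)
  then have "w \<le> B" using assms by (simp add: ennreal_le_iff)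
  then have "w powr r \<le> B powr r" using real assms by (intro powr_mono2) auto
  then show ?thesis using real by (simp add: enn_pow_def ennreal_leI)
qed (use assms in \<open>simp add: top_unique\<close>)

lemma ennreal_le_divide_if_mult_le:
  assumes "ennreal k * v \<le> 1" "k > 0"
  shows "v \<le> ennreal (1 / k)"
proof (cases v)
  case (real w)
  then have "ennreal (k * w) \<le> ennreal 1" using assms by (simp add: ennreal_mult)
  then have "k * w \<le> 1" by (subst (asm) ennreal_le_iff) auto
  then show ?thesis using real assms(2) by (simp add: ennreal_leI field_simps)
qed (use assms in \<open>simp add: ennreal_mult_top top_unique\<close>)

text \<open>Passes from integrability on the pieces of a finite cover to integrability on
  \<open>S\<close>.\<close>

lemma in_Lq_Union:
  fixes U :: "'a::euclidean_space \<Rightarrow> ennreal"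
  assumes S: "S \<in> sets borel" and U: "U \<in> borel_measurable (restrict_space lborel S)"
    and T: "finite T" "S \<subseteq> (\<Union>t\<in>T. W t)" "\<And>t. t \<in> T \<Longrightarrow> W t \<in> sets borel"
    and Lq: "\<And>t. t \<in> T \<Longrightarrow> in_Lq k q (S \<inter> W t) U"
  shows "in_Lq k q S U"
  unfolding in_Lq_def
proof (intro conjI U)
  \<comment> \<open>\<open>U\<close> is only known to be measurable on \<open>S\<close>; cutting it
    off outside gives a Borel function with the same integrals over subsets of
    \<open>S\<close>.\<close>
  define V where "V x = U x * indicator S x" for x
  have [measurable]: "S \<in> sets borel" by fact
  have [measurable]: "V \<in> borel_measurable borel"
    using U S unfolding V_def by (subst (asm) borel_measurable_restrict_space_iff_ennreal) auto
  define f where "f x = ennreal k * enn_pow (V x) q" for x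
  have [measurable]: "f \<in> borel_measurable borel" unfolding f_def by measurable
  have f: "ennreal k * enn_pow (U x) q * indicator A x = f x * indicator A x" if "A \<subseteq> S" for A x
    using that by (auto simp: f_def V_def indicator_def)
  have "(\<integral>\<^sup>+x\<in>S. ennreal k * enn_pow (U x) q \<partial>lborel) = (\<integral>\<^sup>+x\<in>S. f x \<partial>lborel)"
    by (simp add: f)
  also have "\<dots> \<le> (\<integral>\<^sup>+x. (\<Sum>t\<in>T. f x * indicator (S \<inter> W t) x) \<partial>lborel)"
  proof (rule nn_integral_mono)
    fix x
    show "f x * indicator S x \<le> (\<Sum>t\<in>T. f x * indicator (S \<inter> W t) x)"
    proof (cases "x \<in> S")
      case True
      then obtain t where t: "t \<in> T" "x \<in> W t" using T(2) by auto
      have "f x * indicator S x = f x * indicator (S \<inter> W t) x" using t True by simp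
      also have "\<dots> \<le> (\<Sum>t\<in>T. f x * indicator (S \<inter> W t) x)"
        using t T(1) by (intro member_le_sum[where f="\<lambda>t. f x * indicator (S \<inter> W t) x"]) auto
      finally show ?thesis .
    qed simp
  qed
  also have "\<dots> = (\<Sum>t\<in>T. \<integral>\<^sup>+x\<in>S \<inter> W t. f x \<partial>lborel)"
  proof (rule nn_integral_sum)
    fix t assume "t \<in> T"
    then have [measurable]: "W t \<in> sets borel" by (rule T(3))
    show "(\<lambda>x. f x * indicator (S \<inter> W t) x) \<in> borel_measurable lborel" by measurable
  qed
  also have "\<dots> < \<infinity>"
    unfolding infinity_ennreal_def ennreal_sum_less_top[OF T(1)]
  proof
    fix t assume "t \<in> T"
    from Lq[OF this] show "(\<integral>\<^sup>+x\<in>S \<inter> W t. f x \<partial>lborel) < top"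
      by (simp add: in_Lq_def f)
  qed
  finally show "(\<integral>\<^sup>+x\<in>S. ennreal k * enn_pow (U x) q \<partial>lborel) < \<infinity>" .
qed

text \<open>The bound \<open>p / (p - 1)\<close> decreases in \<open>p\<close>, so an exponent
  allowed in codimension \<open>p\<close> is allowed wherever at most \<open>p\<close> facets meet.
  For \<open>m = 0\<close> the quotient is 0, by the convention for division by zero.\<close>

lemma conjugate_exponent_mult_less_1:
  assumes "2 \<le> p" "m \<le> p" "1 \<le> r" "r < real p / (real p - 1)"
  shows "r * ((real m - 1) / real m) < 1"
proof (cases "m = 0")
  case False
  have "r * (real p - 1) < real p" using assms by (simp add: field_simps)
  moreover have "real p - real m \<le> r * (real p - real m)"
    using mult_right_mono[OF assms(3), of "real p - real m"] assms(2) by simp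
  ultimately have "r * (real m - 1) < real m" by (simp add: algebra_simps)
  then show ?thesis using False by (simp add: field_simps)
qed simp

section \<open>The supremum over functions of boundary integral at most 1\<close>

context weighted_simple_polytope
begin

definition admissible :: "('a \<Rightarrow> ennreal) set" where
  "admissible = {u. lsc_on P u \<and> enn_convex_on P u \<and> BI u \<le> 1}"

definition extremal :: "'a \<Rightarrow> ennreal" where
  "extremal x = (SUP u\<in>admissible. u x)"

lemma lsc_extremal: "lsc_on P extremal"
  unfolding extremal_def by (rule lsc_on_SUP) (simp add: admissible_def)

lemma convex_extremal: "enn_convex_on P extremal"
  unfolding extremal_def by (rule enn_convex_on_SUP) (simp add: admissible_def)

lemma extremal_ge: "u \<in> admissible \<Longrightarrow> u x \<le> extremal x"
  unfolding extremal_def by (rule SUP_upper)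

lemma extremal_leI: "(\<And>u. u \<in> admissible \<Longrightarrow> u x \<le> B) \<Longrightarrow> extremal x \<le> B"
  unfolding extremal_def by (rule SUP_least)

text \<open>A small positive constant is admissible. Positivity is what makes the inequality hold
  for functions with infinite boundary integral.\<close>

lemma extremal_pos: "extremal x > 0"
proof -
  define b where "b = enn2real (BI (\<lambda>_. 1))"
  have b: "BI (\<lambda>_. 1) = ennreal b" "b \<ge> 0"
    using boundary_integral_const_finite[of c] by (auto simp: b_def)
  \<comment> \<open>Dividing by \<open>1 + b\<close> rather than \<open>b\<close> avoids a separate
    case \<open>b = 0\<close>.\<close>
  define w where "w = ennreal (1 / (1 + b))"
  have w: "w > 0" "w \<noteq> \<infinity>" using b(2) by (auto simp: w_def)
  have one: "lsc_on P (\<lambda>_. 1)" by (simp add: lsc_on_iff)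
  have cone: "enn_convex_on P (\<lambda>_. 1)"
    unfolding enn_convex_on_def
  proof (intro ballI allI impI)
    fix t :: real assume "0 \<le> t \<and> t \<le> 1"
    then show "1 \<le> ennreal (1 - t) * 1 + ennreal t * 1"
      by (subst mult_1_right, subst mult_1_right, subst ennreal_plus[symmetric]) auto
  qed
  have "BI (\<lambda>_. w * 1) = w * ennreal b"
    unfolding boundary_integral_cmult[OF one] b(1) ..
  also have "\<dots> = ennreal (1 / (1 + b) * b)"
    unfolding w_def using b(2) by (intro ennreal_mult[symmetric]) auto
  also have "\<dots> \<le> ennreal 1" using b(2) by (intro ennreal_leI) simp
  finally have "BI (\<lambda>_. w * 1) \<le> 1" unfolding ennreal_1 .
  moreover have "lsc_on P (\<lambda>_. w * 1)" using w by (intro lsc_on_cmult one) auto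
  moreover have "enn_convex_on P (\<lambda>_. w * 1)" by (rule enn_convex_on_cmult[OF cone])
  ultimately have "(\<lambda>_. w * 1) \<in> admissible" unfolding admissible_def by blast
  from extremal_ge[OF this, of x] have "w \<le> extremal x" unfolding mult_1_right .
  with w(1) show ?thesis by (rule less_le_trans)
qed

text \<open>The interior bound makes \<open>u\<close> vanish in the interior, and lower
  semicontinuity carries this to the boundary. It settles the one case with finite boundary integral
  in which \<open>u\<close> cannot be normalised.\<close>

lemma zero_boundary_integral:
  assumes u: "lsc_on P u" "enn_convex_on P u" and 0: "BI u = 0" and x: "x \<in> P"
  shows "u x = 0"
proof -
  have int: "u y = 0" if y: "y \<in> interior P" for y
  proof -
    obtain \<delta> where \<delta>: "\<delta> > 0" "ball y \<delta> \<subseteq> P" using y by (auto simp: mem_interior)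
    obtain \<kappa> where k: "\<kappa> > 0" "\<And>u y. lsc_on P u \<Longrightarrow> enn_convex_on P u \<Longrightarrow> ball y \<delta> \<subseteq> P \<Longrightarrow> ennreal \<kappa> * u y \<le> BI u"
      using interior_bound[OF \<delta>(1)] by blast
    have "ennreal \<kappa> * u y \<le> 0" using k(2)[OF u \<delta>(2)] 0 by simp
    then show ?thesis using k(1) by simp
  qed
  show ?thesis
  proof (cases "x \<in> interior P")
    case False
    show ?thesis
    proof (rule ccontr)
      assume "u x \<noteq> 0"
      then have "0 < u x" by (simp add: zero_less_iff_neq_zero)
      from lsc_onD[OF u(1) x this] obtain d where d: "d > 0"
        "\<And>y. y \<in> P \<Longrightarrow> y \<noteq> x \<Longrightarrow> dist y x < d \<Longrightarrow> 0 < u y"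
        by (auto simp: eventually_at)
      have "x \<in> closure (interior P)" using x convex_closure_interior[OF convex_P interior_P] closure_subset by auto
      then obtain y where y: "y \<in> interior P" "dist y x < d" using d(1) by (auto simp: closure_approachable)
      have "y \<noteq> x" using y(1) False by auto
      then have "0 < u y" using y interior_subset by (intro d(2)) auto
      then show False using int[OF y(1)] by simp
    qed
  qed (rule int)
qed

text \<open>For a positive finite boundary integral, dividing \<open>u\<close> by it yields an
  admissible function; the values 0 and infinity are treated apart.\<close>

lemma le_boundary_integral_extremal:
  assumes u: "lsc_on P u" "enn_convex_on P u" and x: "x \<in> P"
  shows "u x \<le> BI u * extremal x"
proof (cases "BI u")
  case top
  then show ?thesis using extremal_pos[of x] by (simp add: ennreal_top_mult)
next
  case (real b)
  show ?thesis
  proof (cases "b = 0")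
    case True
    then show ?thesis using zero_boundary_integral[OF u _ x] real by simp
  next
    case False
    then have b: "b > 0" using real by simp
    have "BI (\<lambda>x. ennreal (1 / b) * u x) = ennreal (1 / b) * ennreal b"
      using boundary_integral_cmult[OF u(1)] real by simp
    also have "\<dots> = 1" using b by (simp flip: ennreal_mult)
    finally have "(\<lambda>x. ennreal (1 / b) * u x) \<in> admissible"
      using b u by (auto simp: admissible_def intro!: lsc_on_cmult enn_convex_on_cmult)
    then have "ennreal (1 / b) * u x \<le> extremal x" by (rule extremal_ge)
    then have "ennreal b * (ennreal (1 / b) * u x) \<le> ennreal b * extremal x" by (rule mult_left_mono) simp
    also have "ennreal b * (ennreal (1 / b) * u x) = ennreal (b * (1 / b)) * u x"
      using b by (subst ennreal_mult) (auto simp: mult.assoc)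
    also have "b * (1 / b) = 1" using b by simp
    finally show ?thesis using real by simp
  qed
qed

lemma extremal_locally_bounded:
  assumes "x0 \<in> P - boundary2 P"
  obtains B \<rho> :: real where "B \<ge> 0" "\<rho> > 0" "\<And>x. x \<in> P \<Longrightarrow> dist x x0 < \<rho> \<Longrightarrow> extremal x \<le> ennreal B"
proof -
  obtain \<kappa> \<rho> :: real where *: "\<kappa> > 0" "\<rho> > 0"
    "\<And>u x. lsc_on P u \<Longrightarrow> enn_convex_on P u \<Longrightarrow> x \<in> P \<Longrightarrow> dist x x0 < \<rho> \<Longrightarrow> ennreal \<kappa> * u x \<le> BI u"
    using near_bound_few_facets[of x0] card_act_le_1[OF assms] assms by blast
  have "extremal x \<le> ennreal (1 / \<kappa>)" if "x \<in> P" "dist x x0 < \<rho>" for x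
  proof (rule extremal_leI)
    fix u assume "u \<in> admissible"
    then show "u x \<le> ennreal (1 / \<kappa>)"
      using *(3)[of u x] that *(1)
      by (intro ennreal_le_divide_if_mult_le) (auto simp: admissible_def intro: order_trans)
  qed
  then show thesis using *(1,2) by (intro that[of "1 / \<kappa>" \<rho>]) auto
qed

text \<open>A convex function that is bounded near a point \<open>x0\<close> of a polytope is upper semicontinuous
  there, since \<open>P\<close> is a cone near \<open>x0\<close>.\<close>
lemma continuous_extremal: "continuous_on (P - boundary2 P) extremal"
  unfolding continuous_on_def
proof
  fix x0 assume x0: "x0 \<in> P - boundary2 P"
  then have x0P: "x0 \<in> P" by simp
  obtain B \<rho>1 where B: "B \<ge> 0" "\<rho>1 > 0" "\<And>x. x \<in> P \<Longrightarrow> dist x x0 < \<rho>1 \<Longrightarrow> extremal x \<le> ennreal B"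
    using extremal_locally_bounded[OF x0] by blast
  obtain \<rho>0 where \<rho>0: "\<rho>0 > 0"
    "\<And>z. dist z x0 < \<rho>0 \<Longrightarrow> (\<And>F. F \<in> act x0 \<Longrightarrow> lev F z \<ge> 0) \<Longrightarrow> z \<in> P"
    using locally_cone[OF x0P] by metis
  define \<rho> where "\<rho> = min \<rho>0 \<rho>1"
  have \<rho>: "\<rho> > 0" using \<rho>0(1) B(2) by (simp add: \<rho>_def)
  have at: "at x0 within (P - boundary2 P) \<le> at x0 within P" by (rule at_le) auto
  show "(extremal \<longlongrightarrow> extremal x0) (at x0 within (P - boundary2 P))"
  proof (rule order_tendstoI)
    fix l assume "l < extremal x0"
    from lsc_onD[OF lsc_extremal x0P this]
    show "eventually (\<lambda>x. l < extremal x) (at x0 within (P - boundary2 P))" by (rule filter_leD[OF at])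
  next
    fix l assume l: "extremal x0 < l"
    have "((\<lambda>t. extremal x0 + ennreal (t * B)) \<longlongrightarrow> extremal x0 + ennreal (0 * B)) (at_right (0::real))"
      by (intro tendsto_add tendsto_const tendsto_ennrealI tendsto_mult tendsto_ident_at)
    then have "eventually (\<lambda>t. extremal x0 + ennreal (t * B) < l) (at_right (0::real))"
      using l by (intro order_tendstoD(2)[of _ "extremal x0"]) auto
    then obtain t' where t': "t' > 0" "\<And>t. 0 < t \<Longrightarrow> t < t' \<Longrightarrow> extremal x0 + ennreal (t * B) < l"
      by (auto simp: eventually_at_right_field)
    \<comment> \<open>A weight \<open>t\<close> so small that even the bound \<open>B\<close> at the
      far point raises the value at \<open>x0\<close> by less than the gap to
      \<open>l\<close>.\<close>
    define t where "t = min (t' / 2) (1/2)"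
    have t: "0 < t" "t < t'" "t \<le> 1" using t'(1) by (auto simp: t_def min_def)
    have "extremal x < l" if x: "x \<in> P" "dist x x0 < t * \<rho>" for x
    proof -
      \<comment> \<open>Dilating \<open>x\<close> away from \<open>x0\<close> by \<open>1/t\<close>
        stays in \<open>P\<close>, because the active levels vanish at \<open>x0\<close> and scale
        linearly. Convexity between \<open>x0\<close> and \<open>y\<close> then bounds the value at
        \<open>x\<close>.\<close>
      define y where "y = x0 + (1/t) *\<^sub>R (x - x0)"
      have "dist y x0 = dist x x0 / t" using t(1) by (simp add: y_def dist_norm)
      then have dy: "dist y x0 < \<rho>" using x(2) t(1) by (simp add: pos_divide_less_eq mult.commute)
      have "y \<in> P"
      proof (rule \<rho>0(2))
        show "dist y x0 < \<rho>0" using dy by (simp add: \<rho>_def)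
        fix F assume F: "F \<in> act x0"
        then have "lev F x0 = 0" "lev F x \<ge> 0" using facet_eq[of F] x(1) lev_nonneg[of F x] by (auto simp: act_def)
        then show "lev F y \<ge> 0"
          using lev_diff[of F y x0] lev_diff[of F x x0] t(1) by (simp add: y_def)
      qed
      have "x = (1 - t) *\<^sub>R x0 + t *\<^sub>R y"
        using t(1) by (simp add: y_def algebra_simps)
      then have "extremal x \<le> ennreal (1 - t) * extremal x0 + ennreal t * extremal y"
        using enn_convex_onD[OF convex_extremal x0P \<open>y \<in> P\<close>, of t] t by simp
      also have "\<dots> \<le> 1 * extremal x0 + ennreal t * ennreal B"
        using t dy \<open>y \<in> P\<close> by (intro add_mono mult_mono B(3)) (auto simp: \<rho>_def ennreal_le_1)
      also have "\<dots> < l" using t'(2)[OF t(1,2)] t(1) B(1) by (simp add: ennreal_mult)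
      finally show ?thesis .
    qed
    then have "eventually (\<lambda>x. extremal x < l) (at x0 within P)"
      unfolding eventually_at using t(1) \<rho> by (intro exI[of _ "t * \<rho>"]) auto
    then show "eventually (\<lambda>x. extremal x < l) (at x0 within (P - boundary2 P))"
      by (rule filter_leD[OF at])
  qed
qed

lemma AE_lev_nonzero:
  assumes "F facet_of P"
  shows "AE x in lborel. lev F x \<noteq> 0"
proof (rule AE_I')
  have S: "{x. lev F x = 0} \<in> sets borel"
    using continuous_lev[of UNIV F] by (intro borel_closed closed_Collect_eq) auto
  have "nrm F \<noteq> 0" using norm_nrm[OF assms] by auto
  then have "negligible {x. nrm F \<bullet> x = off F}" by (intro negligible_hyperplane) auto
  then have "{x. lev F x = 0} \<in> null_sets lebesgue" by (simp add: lev_def negligible_iff_null_sets)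
  then show "{x. lev F x = 0} \<in> null_sets lborel" using S by (subst (asm) null_sets_completion_iff) auto
qed auto

lemma measurable_extremal:
  assumes "S \<in> sets borel" "S \<subseteq> P"
  shows "extremal \<in> borel_measurable (restrict_space lborel S)"
proof -
  have [measurable]: "S \<in> sets borel" by fact
  have [measurable]: "(\<lambda>x. extremal x * indicator P x) \<in> borel_measurable borel"
    by (rule borel_measurable_lsc_indicator[OF lsc_extremal closed_P])
  have "(\<lambda>x. extremal x * indicator S x) = (\<lambda>x. (extremal x * indicator P x) * indicator S x)"
    using assms(2) by (auto simp: indicator_def fun_eq_iff)
  also have "\<dots> \<in> borel_measurable borel" by measurable
  finally show ?thesis
    using assms(1) by (subst borel_measurable_restrict_space_iff_ennreal) auto
qed

text \<open>Almost everywhere near \<open>x0\<close> the \<open>r\<close>-th power is at most a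
  constant times the product of the levels to the power \<open>- (r * \<beta>)\<close>. The levels
  come from independent functionals, so this is integrable for \<open>r * \<beta> < 1\<close>. The
  radius is fixed before \<open>r\<close>, so one neighbourhood serves all exponents.\<close>

lemma extremal_locally_in_Lq:
  assumes x0: "x0 \<in> P"
  obtains \<rho> :: real where "\<rho> > 0"
    "\<And>r. 0 \<le> r \<Longrightarrow> r * ((real (card (act x0)) - 1) / real (card (act x0))) < 1 \<Longrightarrow>
       in_Lq k r (P \<inter> ball x0 \<rho>) extremal"
proof -
  define \<beta> where "\<beta> = (real (card (act x0)) - 1) / real (card (act x0))"
  obtain \<kappa> \<rho> :: real where *: "\<kappa> > 0" "\<rho> > 0"
    "\<And>u x. lsc_on P u \<Longrightarrow> enn_convex_on P u \<Longrightarrow> x \<in> P \<Longrightarrow> dist x x0 < \<rho> \<Longrightarrow>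
       (\<And>G. G \<in> act x0 \<Longrightarrow> lev G x > 0) \<Longrightarrow>
       ennreal (\<kappa> * (\<Prod>G\<in>act x0. lev G x powr \<beta>)) * u x \<le> BI u"
    using near_bound_powr[OF x0(1)] unfolding \<beta>_def by blast
  have "in_Lq k r (P \<inter> ball x0 \<rho>) extremal" if r: "0 \<le> r" "r * \<beta> < 1" for r
    unfolding in_Lq_def
  proof
    have [measurable]: "P \<in> sets borel" using closed_P by simp
    show "extremal \<in> borel_measurable (restrict_space lborel (P \<inter> ball x0 \<rho>))"
      by (rule measurable_extremal) auto
    let ?g = "\<lambda>x. indicator (cball x0 \<rho>) x * (\<Prod>G\<in>act x0. ennreal (\<bar>nrm G \<bullet> x - off G\<bar> powr - (r * \<beta>)))"
    define K where "K = ennreal k * ennreal ((1 / \<kappa>) powr r)"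
    \<comment> \<open>The bound by powers requires positive levels; these fail in \<open>P\<close>
      only on the facet hyperplanes, which are null sets.\<close>
    have "AE x in lborel. \<forall>G\<in>act x0. lev G x \<noteq> 0"
      using AE_lev_nonzero by (intro AE_finite_allI finite_act) (auto simp: act_def)
    then have "AE x in lborel. ennreal k * enn_pow (extremal x) r * indicator (P \<inter> ball x0 \<rho>) x \<le> K * ?g x"
    proof eventually_elim
      fix x assume nz: "\<forall>G\<in>act x0. lev G x \<noteq> 0"
      show "ennreal k * enn_pow (extremal x) r * indicator (P \<inter> ball x0 \<rho>) x \<le> K * ?g x"
      proof (cases "x \<in> P \<inter> ball x0 \<rho>")
        case True
        then have x: "x \<in> P" "dist x x0 < \<rho>" by (auto simp: dist_commute)
        have pos: "lev G x > 0" if "G \<in> act x0" for G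
          using nz that lev_nonneg[of G x] x(1) by (force simp: act_def)
        define p where "p = (\<Prod>G\<in>act x0. lev G x powr \<beta>)"
        have "lev G x powr \<beta> > 0" if "G \<in> act x0" for G using pos[OF that] by simp
        then have p: "p > 0" unfolding p_def by (intro prod_pos)
        have "extremal x \<le> ennreal (1 / (\<kappa> * p))"
        proof (rule extremal_leI)
          fix u assume u: "u \<in> admissible"
          have "ennreal (\<kappa> * p) * u x \<le> BI u"
            unfolding p_def using u x pos by (intro *(3)) (auto simp: admissible_def)
          also have "\<dots> \<le> 1" using u by (simp add: admissible_def)
          finally show "u x \<le> ennreal (1 / (\<kappa> * p))" using *(1) p by (intro ennreal_le_divide_if_mult_le) auto
        qed
        then have "enn_pow (extremal x) r \<le> ennreal ((1 / (\<kappa> * p)) powr r)"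
          using *(1) p r(1) by (intro enn_pow_le) auto
        also have "(1 / (\<kappa> * p)) powr r = (1 / \<kappa>) powr r * (1 / p) powr r"
          by (simp flip: powr_mult)
        also have "(1 / p) powr r = (\<Prod>G\<in>act x0. \<bar>nrm G \<bullet> x - off G\<bar> powr - (r * \<beta>))"
        proof -
          have "(1 / p) powr r = p powr (- r)" using p by (simp add: powr_divide powr_minus_divide[of p r])
          also have "\<dots> = (\<Prod>G\<in>act x0. (lev G x powr \<beta>) powr (- r))"
            unfolding p_def by (rule prod_powr_distrib)
          also have "\<dots> = (\<Prod>G\<in>act x0. \<bar>nrm G \<bullet> x - off G\<bar> powr - (r * \<beta>))"
          proof (rule prod.cong[OF refl])
            fix G assume "G \<in> act x0"
            then show "(lev G x powr \<beta>) powr (- r) = \<bar>nrm G \<bullet> x - off G\<bar> powr - (r * \<beta>)"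
              using pos[of G] by (simp add: powr_powr lev_def abs_of_pos mult.commute)
          qed
          finally show ?thesis .
        qed
        finally have "enn_pow (extremal x) r \<le> ennreal ((1 / \<kappa>) powr r) * ennreal (\<Prod>G\<in>act x0. \<bar>nrm G \<bullet> x - off G\<bar> powr - (r * \<beta>))"
          by (simp add: ennreal_mult prod_nonneg)
        then have "ennreal k * enn_pow (extremal x) r \<le> ennreal k * (ennreal ((1 / \<kappa>) powr r) * ennreal (\<Prod>G\<in>act x0. \<bar>nrm G \<bullet> x - off G\<bar> powr - (r * \<beta>)))"
          by (rule mult_left_mono) simp
        moreover have "x \<in> cball x0 \<rho>" using True by auto
        ultimately show ?thesis using True by (simp add: K_def prod_ennreal mult.assoc)
      qed simp
    qed
    then have "(\<integral>\<^sup>+x\<in>P \<inter> ball x0 \<rho>. ennreal k * enn_pow (extremal x) r \<partial>lborel) \<le> (\<integral>\<^sup>+x. K * ?g x \<partial>lborel)"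
      by (rule nn_integral_mono_AE)
    also have "\<dots> = K * (\<integral>\<^sup>+x. ?g x \<partial>lborel)" 
    proof (rule nn_integral_cmult)
      show "?g \<in> borel_measurable lborel"
        by (intro borel_measurable_times_ennreal borel_measurable_indicator borel_measurable_prod_ennreal) auto
    qed
    also have "\<dots> < \<infinity>"
      using nn_integral_prod_abs_powr_finite[OF act_independent(1,2)[OF x0] r(2), of x0 \<rho> off]
      by (simp add: K_def ennreal_mult_less_top)
    finally show "(\<integral>\<^sup>+x\<in>P \<inter> ball x0 \<rho>. ennreal k * enn_pow (extremal x) r \<partial>lborel) < \<infinity>" .
  qed
  then show thesis using *(2) unfolding \<beta>_def by (intro that[of \<rho>]) auto
qed

text \<open>At most \<open>DIM('a)\<close> facets meet at a point, so the exponent is admissible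
  near every point of \<open>P\<close>, and compactness leaves a finite cover.\<close>

lemma extremal_in_Lq:
  assumes n: "DIM('a) \<ge> 2" and q: "1 \<le> q" "q < real DIM('a) / (real DIM('a) - 1)"
  shows "in_Lq k q P extremal"
proof -
  have "\<exists>\<rho>>0. in_Lq k q (P \<inter> ball x \<rho>) extremal" if x: "x \<in> P" for x
  proof -
    obtain \<rho> :: real where "\<rho> > 0"
      "\<And>r. 0 \<le> r \<Longrightarrow> r * ((real (card (act x)) - 1) / real (card (act x))) < 1 \<Longrightarrow> in_Lq k r (P \<inter> ball x \<rho>) extremal"
      using extremal_locally_in_Lq[OF x] by blast
    moreover have "q * ((real (card (act x)) - 1) / real (card (act x))) < 1"
      by (rule conjugate_exponent_mult_less_1[OF n act_independent(3)[OF x] q])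
    ultimately show ?thesis using q(1) by auto
  qed
  then obtain \<rho> where \<rho>: "\<And>x. x \<in> P \<Longrightarrow> \<rho> x > 0" "\<And>x. x \<in> P \<Longrightarrow> in_Lq k q (P \<inter> ball x (\<rho> x)) extremal"
    by metis
  have op: "\<And>x. x \<in> P \<Longrightarrow> open (ball x (\<rho> x))" by simp
  have cov: "P \<subseteq> (\<Union>x\<in>P. ball x (\<rho> x))" using \<rho>(1) by force
  obtain T where T: "T \<subseteq> P" "finite T" "P \<subseteq> (\<Union>x\<in>T. ball x (\<rho> x))"
    by (rule compactE_image[OF compact_P op cov])
  have P: "P \<in> sets borel" using closed_P by simp
  show ?thesis
    by (rule in_Lq_Union[OF P measurable_extremal[OF P order_refl] T(2,3)]) (use \<rho>(2) T(1) in auto)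
qed

end

theorem mainTheorem6:
  fixes P :: "'a::euclidean_space set" and cmu :: real and c :: "'a set \<Rightarrow> real"
  assumes "nsystem P cmu c" and "DIM('a) \<ge> 2"
  shows "\<exists>U :: 'a \<Rightarrow> ennreal.
     lsc_on P U \<and> enn_convex_on P U \<and>
     (\<forall>q. 1 \<le> q \<and> q < real DIM('a) / (real DIM('a) - 1) \<longrightarrow> in_Lq cmu q P U) \<and>
     (\<forall>u :: 'a \<Rightarrow> ennreal. lsc_on P u \<and> enn_convex_on P u \<longrightarrow>
        (\<forall>x\<in>P. u x \<le> boundary_integral P c u * U x)) \<and>
     (\<forall>x\<in>P - boundary2 P. U x < \<infinity>) \<and> continuous_on (P - boundary2 P) U \<and>
     (\<forall>G x. \<forall>p::nat. G face_of P \<and> p \<ge> 2 \<and> aff_dim G = int DIM('a) - int p \<and>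
        x \<in> rel_interior G \<longrightarrow>
        (\<exists>W. open W \<and> x \<in> W \<and>
           (\<forall>r. 1 \<le> r \<and> r < real p / (real p - 1) \<longrightarrow> in_Lq cmu r (P \<inter> W) U)))"
proof -
  interpret weighted_simple_polytope P c
    using assms(1) by unfold_locales (auto simp: nsystem_def)
  have finite: "extremal x < \<infinity>" if x: "x \<in> P - boundary2 P" for x
  proof -
    obtain B \<rho> :: real where "\<rho> > 0" "\<And>y. y \<in> P \<Longrightarrow> dist y x < \<rho> \<Longrightarrow> extremal y \<le> ennreal B"
      using extremal_locally_bounded[OF x] by blast
    then have "extremal x \<le> ennreal B" using x by simp
    then show ?thesis by (simp add: le_less_trans)
  qed
  have local: "\<exists>W. open W \<and> x \<in> W \<and> (\<forall>r. 1 \<le> r \<and> r < real p / (real p - 1) \<longrightarrow> in_Lq cmu r (P \<inter> W) extremal)"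
    if G: "G face_of P" "p \<ge> 2" "aff_dim G = int DIM('a) - int p" "x \<in> rel_interior G" for G x and p :: nat
  proof -
    have x: "x \<in> P" using G(1,4) rel_interior_subset face_of_imp_subset by blast
    \<comment> \<open>At most \<open>p\<close> facets meet at \<open>x\<close>, so every
      \<open>r < p / (p - 1)\<close> satisfies the local exponent condition, and the ball of the
      local estimate is the required neighbourhood.\<close>
    have "card (act x) \<le> p" using card_act_le_codim[OF G(1,4)] G(3) by simp
    moreover obtain \<rho> :: real where \<rho>: "\<rho> > 0"
      "\<And>r. 0 \<le> r \<Longrightarrow> r * ((real (card (act x)) - 1) / real (card (act x))) < 1 \<Longrightarrow> in_Lq cmu r (P \<inter> ball x \<rho>) extremal"
      using extremal_locally_in_Lq[OF x] by blast
    ultimately show ?thesis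
      using conjugate_exponent_mult_less_1[OF G(2), of "card (act x)"] by (intro exI[of _ "ball x \<rho>"]) auto
  qed
  show ?thesis
  proof (intro exI[of _ extremal] conjI allI impI ballI)
    show "in_Lq cmu q P extremal" if "1 \<le> q \<and> q < real DIM('a) / (real DIM('a) - 1)" for q
      using extremal_in_Lq[OF assms(2)] that by simp
    show "u x \<le> BI u * extremal x" if "lsc_on P u \<and> enn_convex_on P u" "x \<in> P" for u x
      using le_boundary_integral_extremal that by simp
    show "\<exists>W. open W \<and> x \<in> W \<and> (\<forall>r. 1 \<le> r \<and> r < real p / (real p - 1) \<longrightarrow> in_Lq cmu r (P \<inter> W) extremal)"
      if "G face_of P \<and> p \<ge> 2 \<and> aff_dim G = int DIM('a) - int p \<and> x \<in> rel_interior G" for G x and p :: nat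
      using that by (intro local[of G p x]) auto
  qed (fact lsc_extremal convex_extremal finite continuous_extremal)+
qed

end
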